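(* Let $I=I_x=(\lambda_1,\lambda_2)$, with $\lambda_i=\lambda_i(x)$ and $0\le\lambda_1(x)<\lambda_2(x)<\infty$ for $x\ge 1$, be a system of intervals satisfying one of the following two conditions: (i) $\lambda_1(x)=0$ for all $x$, $\lambda_2 x\to\infty$ as $x\to\infty$, and there is a constant $c_1>0$ such that $\log x/\log(\lambda_2 x)<c_1$ for all sufficiently large $x$; (ii) $\lambda_1(x)>0$ for all $x$, and there are positive constants $c_2,c_3$ such that $$\frac{c_2}{\log(\lambda_2+2)}<\lambda_1<\lambda_2<x^{c_3},\qquad \frac{1}{\log(\lambda_2+2)}\cdot\log\Big(\frac{\lambda_2}{\lambda_1}\Big)\cdot\log x\to\infty,\quad x\to\infty.$$ Then for arbitrary sets $A,B\subset\mathbb{N}$ and every $q\in\mathbb{N}$ the limit $$\nu^{11}\big(\mathcal{M}(A,B|q)\big)=\lim_{x\to\infty}\nu_x^{11}\big(\mathcal{M}(A,B|q)\big)$$ exists.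
   Context: $\mathbb{N}$ is the set of positive integers and $\mathbb{Q}^+$ the set of positive rationals. $m\perp n$ means $\gcd(m,n)=1$. Every $r\in\mathbb{Q}^+$ is written uniquely as $r=m/n$ with $m,n\in\mathbb{N}$, $m\perp n$; all sets and sums of fractions $m/n$ refer to this reduced representation. For $A\subset\mathbb{N}$, $\mathcal{M}(A)$ is the set of positive integers divisible by at least one $a\in A$. For $A,B\subset\mathbb{N}$ and $q\in\mathbb{N}$, $$\mathcal{M}(A,B|q)=\Big\{\frac{m}{n}\in\mathbb{Q}^+:\ m\perp n,\ m\in\mathcal{M}(A),\ n\in\mathcal{M}(B),\ mn\perp q\Big\}.$$ For an interval $I=I_x=(\lambda_1(x),\lambda_2(x))\subset(0,+\infty)$ (where $\lambda_1=0$ is allowed), let $\mathcal{F}_x^I=\{m/n\in\mathbb{Q}^+: m\perp n,\ n\le x,\ m/n\in I\}$. For $R\subset\mathbb{Q}^+$, if $\mathcal{F}_x^I\ne\emptyset$, put $$S^{11}_{x,I}(R)=\sum_{m/n\in\mathcal{F}_x^I\cap R}\frac{1}{mn},\qquad \nu_x^{11}(R)=\frac{S^{11}_{x,I}(R)}{S^{11}_{x,I}(\mathcal{F}_x^I)}.$$ *)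

theory Defs
  imports "HOL-Analysis.Analysis"
begin

text \<open>Numerator and denominator of the reduced representation; for positive \<open>r\<close> both are
  positive and coprime, and \<open>r\<close> is their quotient (see \<open>rat_reduced\<close>).\<close>

definition rnum :: "rat \<Rightarrow> nat" where
  "rnum r = nat (fst (quotient_of r))"

definition rden :: "rat \<Rightarrow> nat" where
  "rden r = nat (snd (quotient_of r))"

definition multiples :: "nat set \<Rightarrow> nat set" where
  "multiples A = {k. k > 0 \<and> (\<exists>a\<in>A. a dvd k)}"

definition rat_multiples :: "nat set \<Rightarrow> nat set \<Rightarrow> nat \<Rightarrow> rat set" where
  "rat_multiples A B q =
     {r. r > 0 \<and> rnum r \<in> multiples A \<and> rden r \<in> multiples B \<and> coprime (rnum r * rden r) q}"

definition farey :: "real \<Rightarrow> real set \<Rightarrow> rat set" where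
  "farey x I = {r. r > 0 \<and> real (rden r) \<le> x \<and> of_rat r \<in> I}"

definition S11 :: "real \<Rightarrow> real set \<Rightarrow> rat set \<Rightarrow> real" where
  "S11 x I R = (\<Sum>r \<in> farey x I \<inter> R. 1 / (real (rnum r) * real (rden r)))"

text \<open>Meaningful for nonempty \<open>farey x I\<close> only; if that set is empty, the value is \<open>0\<close>.\<close>

definition nu11 :: "real \<Rightarrow> real set \<Rightarrow> rat set \<Rightarrow> real" where
  "nu11 x I R = S11 x I R / S11 x I (farey x I)"

lemma rat_reduced:
  assumes "r > 0"
  shows "rnum r > 0" "rden r > 0" "coprime (rnum r) (rden r)"
    "r = of_nat (rnum r) / of_nat (rden r)"
proof -
  obtain p d where pd: "quotient_of r = (p, d)" by (cases "quotient_of r")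
  have d: "d > 0" using quotient_of_denom_pos[OF pd] .
  have r: "r = of_int p / of_int d" using quotient_of_div[OF pd] .
  have p: "p > 0" using assms d unfolding r by (simp add: zero_less_divide_iff)
  have c: "coprime p d" using quotient_of_coprime[OF pd] .
  have num: "int (rnum r) = p" and den: "int (rden r) = d"
    using p d pd by (simp_all add: rnum_def rden_def)
  show "rnum r > 0" "rden r > 0" using num den p d by linarith+
  show "coprime (rnum r) (rden r)" using c unfolding num[symmetric] den[symmetric] by simp
  show "r = of_nat (rnum r) / of_nat (rden r)"
    using r unfolding num[symmetric] den[symmetric] by simp
qed

lemma rden_le:
  assumes "m > 0" "n > 0"
  shows "rden (of_nat m / of_nat n) \<le> n"
proof -
  define r :: rat where "r = of_nat m / of_nat n"
  have r0: "r > 0" using assms by (simp add: r_def)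
  note R = rat_reduced[OF r0]
  have "of_nat (rnum r) / of_nat (rden r) = (of_nat m / of_nat n :: rat)"
    using R(4) r_def by metis
  then have "(of_nat (rnum r * n) :: rat) = of_nat (m * rden r)"
    using R(2) assms(2) by (simp add: frac_eq_eq)
  then have "rnum r * n = m * rden r" by (simp only: of_nat_eq_iff)
  then have "rden r dvd rnum r * n" by simp
  then have "rden r dvd n"
    using R(3) by (simp add: coprime_dvd_mult_right_iff coprime_commute)
  then show ?thesis using assms dvd_imp_le r_def by blast
qed

lemma finite_farey: "finite (farey x {a<..<b})"
proof (rule finite_subset)
  let ?D = "{..nat \<lceil>x\<rceil>}" and ?N = "{..nat \<lceil>\<bar>b\<bar> * \<bar>x\<bar>\<rceil>}"
  show "finite ((\<lambda>(m, n). of_nat m / of_nat n :: rat) ` (?N \<times> ?D))" by simp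
  show "farey x {a<..<b} \<subseteq> (\<lambda>(m, n). of_nat m / of_nat n) ` (?N \<times> ?D)"
  proof
    fix r assume "r \<in> farey x {a<..<b}"
    then have r: "r > 0" "real (rden r) \<le> x" "of_rat r < b" by (auto simp: farey_def)
    note R = rat_reduced[OF r(1)]
    have "(of_rat r :: real) = real (rnum r) / real (rden r)"
      by (subst R(4)) (simp add: of_rat_divide)
    then have "real (rnum r) < b * real (rden r)" using r(3) R(2) by (simp add: pos_divide_less_eq)
    also have "\<dots> \<le> \<bar>b\<bar> * \<bar>x\<bar>" using r(2) by (intro mult_mono) auto
    finally have "rnum r \<in> ?N" by simp linarith
    moreover have "rden r \<in> ?D" using r(2) by simp linarith
    ultimately show "r \<in> (\<lambda>(m, n). of_nat m / of_nat n) ` (?N \<times> ?D)"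
      using R(4) by (intro image_eqI[of _ _ "(rnum r, rden r)"]) auto
  qed
qed

lemma farey_nonempty:
  assumes "0 \<le> a" "x \<ge> 2" "x * (b - a) > 2"
  shows "farey x {a<..<b} \<noteq> {}"
proof -
  define n where "n = nat \<lfloor>x\<rfloor>"
  define m where "m = nat (\<lfloor>real n * a\<rfloor> + 1)"
  have n: "real n \<le> x" "x / 2 \<le> real n" "n > 0" using assms(2) unfolding n_def by linarith+
  have ba: "b - a > 0"
    using assms(2,3) by (metis zero_less_mult_pos order_less_trans zero_less_numeral
        order_less_le_trans)
  have "1 < (x / 2) * (b - a)" using assms(3) by simp
  also have "\<dots> \<le> real n * (b - a)" using n ba by (intro mult_right_mono) auto
  finally have gap: "real n * a + 1 < real n * b" by (simp add: algebra_simps)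
  have na: "real n * a \<ge> 0" using assms(1) by simp
  have m: "m > 0" "real n * a < real m" "real m \<le> real n * a + 1"
    using na unfolding m_def by linarith+
  define r :: rat where "r = of_nat m / of_nat n"
  have "r > 0" using m n by (simp add: r_def)
  moreover have "real (rden r) \<le> x" using rden_le[OF m(1) n(3)] n(1) unfolding r_def by linarith
  moreover have "(of_rat r :: real) = real m / real n" by (simp add: r_def of_rat_divide)
  then have "of_rat r \<in> {a<..<b}"
    using m gap n(3) by (simp add: pos_divide_less_eq pos_less_divide_eq mult.commute)
  ultimately have "r \<in> farey x {a<..<b}" by (simp add: farey_def)
  then show ?thesis by blast
qed

lemma eventually_farey_nonempty_i:
  assumes "\<forall>x\<ge>1. lam\<^sub>1 x = 0" "filterlim (\<lambda>x. lam\<^sub>2 x * x) at_top at_top"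
  shows "\<forall>\<^sub>F x in at_top. farey x {lam\<^sub>1 x<..<lam\<^sub>2 x} \<noteq> {}"
proof -
  have "\<forall>\<^sub>F x in at_top. lam\<^sub>2 x * x > 2" using assms(2) by (simp add: filterlim_at_top_dense)
  then show ?thesis using eventually_ge_at_top[of 2]
  proof eventually_elim
    case (elim x)
    then show ?case using assms(1) by (intro farey_nonempty) (auto simp: mult.commute)
  qed
qed

lemma eventually_farey_nonempty_ii:
  assumes "c\<^sub>2 > 0"
    and "\<forall>\<^sub>F x in at_top. c\<^sub>2 / ln (lam\<^sub>2 x + 2) < lam\<^sub>1 x \<and> lam\<^sub>1 x < lam\<^sub>2 x"
    and "\<forall>x\<ge>1. lam\<^sub>1 x > 0"
    and "filterlim (\<lambda>x. 1 / ln (lam\<^sub>2 x + 2) * ln (lam\<^sub>2 x / lam\<^sub>1 x) * ln x) at_top at_top"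
  shows "\<forall>\<^sub>F x in at_top. farey x {lam\<^sub>1 x<..<lam\<^sub>2 x} \<noteq> {}"
proof -
  have "\<forall>\<^sub>F x in at_top. 1 / ln (lam\<^sub>2 x + 2) * ln (lam\<^sub>2 x / lam\<^sub>1 x) * ln x > 2 / c\<^sub>2"
    using assms(4) by (simp add: filterlim_at_top_dense)
  then show ?thesis using eventually_ge_at_top[of 2] assms(2)
  proof eventually_elim
    case (elim x)
    define a b L t where "a = lam\<^sub>1 x" and "b = lam\<^sub>2 x" and "L = ln (b + 2)" and "t = ln (b / a)"
    have a: "a > 0" "a < b" "c\<^sub>2 / L < a" using elim assms(3) by (auto simp: a_def b_def L_def)
    have L: "L > 0" using a by (simp add: L_def)
    have t: "t > 0" using a by (simp add: t_def)
    have "t \<le> b / a - 1" unfolding t_def using a by (intro ln_le_minus_one) simp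
    then have ba: "a * t \<le> b - a" using a by (simp add: field_simps)
    have x: "0 < ln x" "ln x \<le> x" using elim(2) ln_le_minus_one[of x] by auto
    have "2 < c\<^sub>2 * (1 / L * t * ln x)"
      using elim(1) assms(1) by (simp add: a_def b_def L_def t_def field_simps)
    also have "\<dots> = ln x * (c\<^sub>2 / L * t)" by simp
    also have "\<dots> \<le> x * (a * t)"
      using x a L t assms(1) by (intro mult_mono) auto
    also have "\<dots> \<le> x * (b - a)" using ba elim(2) by (intro mult_left_mono) auto
    finally show ?case using a elim(2) unfolding a_def b_def by (intro farey_nonempty) auto
  qed
qed

end

theory Submission
  imports Defs "HOL-Computational_Algebra.Primes"
begin

text \<open>
  Count all pairs \<open>(m, n)\<close> of the region \<open>n \<le> x\<close>, \<open>lam\<^sub>1 n < m < lam\<^sub>2 n\<close> with weight \<open>1 / (m n)\<close>,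
  coprime or not. Abel summation along rows and columns shows that every condition on \<open>(m, n)\<close> that
  is periodic in both variables has a limiting frequency, the errors being negligible precisely under
  (i) or (ii). Coprimality, \<open>m \<in> M(A)\<close> and \<open>n \<in> M(B)\<close> become periodic after truncation at \<open>z\<close>.
  The truncation error for coprimality is at most \<open>\<Sum>d>z. 1 / d\<^sup>2\<close>, because dividing a pair by a common
  divisor stays in the region; for \<open>A\<close> and \<open>B\<close> it is controlled by the Davenport--Erdos theorem: the
  integers in \<open>M(A)\<close> that are not multiples of a small element of \<open>A\<close> have small upper logarithmic
  density. So the frequency of the coprime pairs in question and that of all coprime pairs
  converge, the latter to a limit of at least \<open>1 / 4\<close>, and the quotient converges.
\<close>

subsection \<open>A Jordan totient with real exponent\<close>

text \<open>A set of multiples need not have a natural density, as Besicovitch showed, but it always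
  has a logarithmic one. The weight 1 / (m n) turns the problem into one about harmonic sums, where
  logarithmic density is what counts. Coprimality couples the two variables; without it every row
  and column of the region is a plain integer interval, which is why all pairs are counted and
  coprimality is imposed on them afterwards.

  The order of choices matters: the tolerance fixes how thin the exceptional sets must be, this
  fixes the truncation point, which fixes the period, and only then does \<open>x\<close> grow. The
  Abel error grows with the period, but the period is a constant by then. The value of the limit is
  never computed; its existence comes from a Cauchy argument over the tolerances.

  Logarithmic density is reached through the weights \<open>m powr - s\<close> with
  \<open>s > 1\<close>: among all positive integers, the share of a set closed under multiples can
  only grow as \<open>s\<close> decreases to 1. Jordan's totient provides the coefficients that
  prove this.\<close>

text \<open>For a positive integer \<open>t\<close> this is Jordan's totient. Its Dirichlet series
  at \<open>s\<close> is zeta(s - t) / zeta(s), so its nonnegative values turn zeta at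
  \<open>s\<close> into zeta at the smaller exponent \<open>s - t\<close>, for real \<open>t\<close>
  as well.\<close>

definition jordan :: "real \<Rightarrow> nat \<Rightarrow> real" where
  "jordan t n = real n powr t * (\<Prod>p\<in>prime_factors n. 1 - real p powr - t)"

lemma jordan_bounds:
  assumes "t \<ge> 0"
  shows "0 \<le> jordan t n" "jordan t n \<le> real n powr t"
proof -
  have f: "0 \<le> 1 - real p powr - t \<and> 1 - real p powr - t \<le> 1" if "p \<in> prime_factors n" for p
  proof -
    have "real p \<ge> 1" using that prime_ge_1_nat by auto
    then have "real p powr - t \<le> real p powr 0" using assms by (intro powr_mono) auto
    then show ?thesis using \<open>real p \<ge> 1\<close> by simp
  qed
  then have P: "0 \<le> (\<Prod>p\<in>prime_factors n. 1 - real p powr - t)"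
    "(\<Prod>p\<in>prime_factors n. 1 - real p powr - t) \<le> 1"
    by (auto intro!: prod_nonneg prod_le_1)
  show "0 \<le> jordan t n" using P by (simp add: jordan_def)
  show "jordan t n \<le> real n powr t"
    using P by (simp add: jordan_def mult_left_le)
qed

lemma jordan_prime_power_mult:
  assumes "prime p" "\<not> p dvd d" "k > 0"
  shows "jordan t (p ^ k * d) = real (p ^ k) powr t * (1 - real p powr - t) * jordan t d"
proof -
  have d: "d \<noteq> 0" using assms by (metis dvd_0_right)
  have p: "p \<noteq> 0" using assms prime_gt_0_nat by auto
  have "prime_factors (p ^ k * d) = prime_factors (p ^ k) \<union> prime_factors d"
    using d p by (intro prime_factors_product) auto
  also have "prime_factors (p ^ k) = {p}"
    using assms by (simp add: prime_factorization_prime_power)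
  finally have "prime_factors (p ^ k * d) = insert p (prime_factors d)" by simp
  moreover have "p \<notin> prime_factors d" using assms by (auto simp: prime_factors_dvd)
  ultimately show ?thesis by (simp add: jordan_def powr_mult mult_ac)
qed

text \<open>Splitting off the divisors \<open>p ^ k * d\<close> that carry the full power of \<open>p\<close> makes the sum
  telescope.\<close>

lemma jordan_divisor_sum:
  assumes "n > 0"
  shows "(\<Sum>d | d dvd n. jordan t d) = real n powr t"
  using assms
proof (induction n rule: less_induct)
  case (less n)
  show ?case
  proof (cases "n = 1")
    case True
    then show ?thesis by (simp add: jordan_def)
  next
    case False
    then obtain p where p: "prime p" "p dvd n" using prime_factor_nat by blast
    have p0: "p > 0" using p prime_gt_0_nat by blast
    have p1: "p > 1" using p prime_gt_1_nat by blast
    define k where "k = multiplicity p n"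
    obtain m where m: "n = p ^ k * m" "\<not> p dvd m"
      using multiplicity_decompose'[of n p] less.prems p(1) unfolding k_def
      by (metis not_prime_unit less_numeral_extra(3))
    have k0: "k > 0"
      using m p(2) by (metis gr0I mult.left_neutral power_0)
    define k' where "k' = k - 1"
    have kk: "k = Suc k'" using k0 by (simp add: k'_def)
    have m0: "m > 0" using m less.prems by (metis mult_0_right neq0_conv)
    have n': "n = p * (p ^ k' * m)" using m kk by simp
    have n'0: "p ^ k' * m > 0" using p0 m0 by simp
    have lt: "p ^ k' * m < n" "m < n"
    proof -
      show "p ^ k' * m < n" using n' n'0 p1 by (metis mult_less_cancel2 nat_mult_1)
      moreover have "m \<le> p ^ k' * m" using p0 by simp
      ultimately show "m < n" by (rule le_less_trans[rotated])
    qed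
    have div: "{d. d dvd n} = {d. d dvd p ^ k' * m} \<union> (\<lambda>d. p ^ k * d) ` {d. d dvd m}"
    proof (intro equalityI subsetI)
      fix d assume "d \<in> {d. d dvd n}"
      then have dn: "d dvd n" by simp
      then have d0: "d > 0" using less.prems by (metis dvd_0_left neq0_conv less_numeral_extra(3))
      obtain e where e: "d = p ^ multiplicity p d * e" "\<not> p dvd e"
        using multiplicity_decompose'[of d p] d0 p(1)
        by (metis not_prime_unit less_numeral_extra(3))
      define j where "j = multiplicity p d"
      have jk: "j \<le> k" unfolding j_def k_def using dn less.prems
        by (intro dvd_imp_multiplicity_le) auto
      have "e dvd p ^ k * m" using dn e m(1) by (metis dvd_mult_right)
      moreover have "coprime e (p ^ k)"
        using prime_imp_coprime[OF p(1) e(2)] by (simp add: coprime_commute)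
      ultimately have em: "e dvd m" by (simp add: coprime_dvd_mult_right_iff)
      show "d \<in> {d. d dvd p ^ k' * m} \<union> (\<lambda>d. p ^ k * d) ` {d. d dvd m}"
      proof (cases "j = k")
        case True
        then show ?thesis using e em unfolding j_def[symmetric] by auto
      next
        case False
        then have "p ^ j dvd p ^ k'" using jk kk by (intro le_imp_power_dvd) auto
        then show ?thesis using e em unfolding j_def[symmetric] by (auto intro: mult_dvd_mono)
      qed
    next
      fix d assume "d \<in> {d. d dvd p ^ k' * m} \<union> (\<lambda>d. p ^ k * d) ` {d. d dvd m}"
      then show "d \<in> {d. d dvd n}" using n' m
        by (metis (mono_tags, lifting) UnE dvd_mult image_iff mem_Collect_eq mult_dvd_mono dvd_refl)
    qed
    have disj: "{d. d dvd p ^ k' * m} \<inter> (\<lambda>d. p ^ k * d) ` {d. d dvd m} = {}"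
    proof -
      have "\<not> p ^ k * d dvd p ^ k' * m" for d
      proof
        assume "p ^ k * d dvd p ^ k' * m"
        then have "p ^ k dvd p ^ k' * m" by (rule dvd_mult_left)
        then have "p ^ k' * p dvd p ^ k' * m" using kk by (simp only: power_Suc2)
        then show False using m p0 by simp
      qed
      then show ?thesis by auto
    qed
    have "(\<Sum>d | d dvd n. jordan t d)
      = (\<Sum>d | d dvd p ^ k' * m. jordan t d) + (\<Sum>d\<in>(\<lambda>d. p ^ k * d) ` {d. d dvd m}. jordan t d)"
      unfolding div using n'0 m0 disj by (intro sum.union_disjoint) auto
    also have "(\<Sum>d\<in>(\<lambda>d. p ^ k * d) ` {d. d dvd m}. jordan t d)
        = (\<Sum>d | d dvd m. jordan t (p ^ k * d))"
      using p0 by (subst sum.reindex) (auto simp: inj_on_def)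
    also have "\<dots> = (\<Sum>d | d dvd m. real (p ^ k) powr t * (1 - real p powr - t) * jordan t d)"
      using m p(1) k0 by (intro sum.cong refl jordan_prime_power_mult) (auto dest: dvd_trans)
    also have "\<dots> = real (p ^ k) powr t * (1 - real p powr - t) * real m powr t"
      using less.IH[OF lt(2) m0] by (simp add: sum_distrib_left[symmetric])
    also have "(\<Sum>d | d dvd p ^ k' * m. jordan t d) = real (p ^ k' * m) powr t"
      by (rule less.IH[OF lt(1) n'0])
    also have "real (p ^ k' * m) powr t = real n powr t * real p powr - t"
      unfolding n' using p0 by (simp add: powr_mult powr_minus field_simps)
    also have "real (p ^ k) powr t * (1 - real p powr - t) * real m powr t
       = real n powr t * (1 - real p powr - t)"
      by (simp add: m(1) powr_mult)
    finally show ?thesis by (simp add: algebra_simps)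
  qed
qed

subsection \<open>Zeta sums over sets closed under multiples\<close>

text \<open>On \<open>UNIV\<close> this is the zeta function: \<open>0 powr - s\<close> is 0, so the
  number 0 adds nothing.\<close>

definition zsum :: "real \<Rightarrow> nat set \<Rightarrow> real" where
  "zsum s M = (\<Sum>\<^sub>\<infinity>m\<in>M. real m powr - s)"

lemma powr_summable_on: "s > 1 \<Longrightarrow> (\<lambda>m. real m powr - s) summable_on (M :: nat set)"
  using summable_on_subset_banach[OF norm_summable_imp_summable_on, of "\<lambda>m. real m powr - s" M]
    summable_real_powr_iff[of "- s"] by simp

lemma zsum_mono: "s > 1 \<Longrightarrow> M \<subseteq> N \<Longrightarrow> zsum s M \<le> zsum s N"
  unfolding zsum_def by (intro infsum_mono2 powr_summable_on) auto

lemma zsum_nonneg: "zsum s M \<ge> 0"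
  unfolding zsum_def by (intro infsum_nonneg) auto

lemma zsum_pos: "s > 1 \<Longrightarrow> zsum s UNIV > 0"
proof -
  assume s: "s > 1"
  have "(\<Sum>m\<in>{1::nat}. real m powr - s) \<le> zsum s UNIV"
    unfolding zsum_def by (intro finite_sum_le_infsum powr_summable_on s) auto
  then show ?thesis by simp
qed

lemma inverse_Suc_le_ln:
  assumes "m > 0"
  shows "1 / real (Suc m) \<le> ln (real (Suc m) / real m)"
    and "ln (real (Suc m) / real m) \<le> 1 / real m"
proof -
  have "ln (real m / real (Suc m)) \<le> real m / real (Suc m) - 1"
    using assms by (intro ln_le_minus_one) auto
  also have "real m / real (Suc m) - 1 = - (1 / real (Suc m))" by (simp add: field_simps)
  finally show "1 / real (Suc m) \<le> ln (real (Suc m) / real m)"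
    using assms by (simp add: ln_div)
  have "ln (real (Suc m) / real m) \<le> real (Suc m) / real m - 1"
    using assms by (intro ln_le_minus_one) auto
  also have "\<dots> = 1 / real m" using assms by (simp add: field_simps)
  finally show "ln (real (Suc m) / real m) \<le> 1 / real m" .
qed

text \<open>Induction in place of an integral comparison: the new term \<open>b powr - s\<close> is
  at most the integral of \<open>t powr - s\<close> over the unit interval ending at
  \<open>b\<close>. This comes from exp v >= 1 + v at v = (s - 1) ln (b / a), together with ln (b /
  a) >= 1 / b.\<close>

lemma sum_powr_le:
  assumes "s > 1"
  shows "(\<Sum>m=1..Suc k. real m powr - s) \<le> 1 + (1 - real (Suc k) powr (1 - s)) / (s - 1)"
proof (induction k)
  case 0
  then show ?case by simp
next
  case (Suc k)
  define a b where "a = real (Suc k)" and "b = real (Suc (Suc k))"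
  have ab: "a > 0" "b > 0" by (auto simp: a_def b_def)
  have "1 + (s - 1) * (1 / b) \<le> 1 + (s - 1) * ln (b / a)"
    using inverse_Suc_le_ln(1)[of "Suc k"] assms
    by (intro add_left_mono mult_left_mono) (auto simp: a_def b_def)
  also have "\<dots> \<le> exp ((s - 1) * ln (b / a))" using exp_ge_add_one_self by simp
  also have "\<dots> = b powr (s - 1) / a powr (s - 1)"
    using ab by (simp add: powr_def ln_div exp_diff right_diff_distrib)
  finally have "b powr (1 - s) * (1 + (s - 1) * (1 / b))
      \<le> b powr (1 - s) * (b powr (s - 1) / a powr (s - 1))"
    by (intro mult_left_mono) auto
  also have "\<dots> = b powr 0 * a powr (1 - s)"
    using ab by (simp add: powr_add[symmetric] divide_powr_uminus)
  finally have "b powr (1 - s) + (s - 1) * (b powr (1 - s) / b) \<le> a powr (1 - s)"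
    using ab by (simp add: algebra_simps)
  moreover have "b powr (1 - s) / b = b powr - s"
    using ab by (simp add: powr_diff powr_minus field_simps)
  ultimately have "(s - 1) * b powr - s \<le> a powr (1 - s) - b powr (1 - s)" by simp
  then have "b powr - s \<le> (a powr (1 - s) - b powr (1 - s)) / (s - 1)"
    using assms by (simp add: pos_le_divide_eq mult.commute)
  then have "b powr - s \<le> a powr (1 - s) / (s - 1) - b powr (1 - s) / (s - 1)"
    by (simp add: diff_divide_distrib)
  then show ?case using Suc by (simp add: a_def b_def diff_divide_distrib)
qed

lemma zsum_UNIV_le:
  assumes "s > 1"
  shows "zsum s UNIV \<le> 1 + 1 / (s - 1)"
  unfolding zsum_def
proof (rule infsum_le_finite_sums[OF powr_summable_on[OF assms]])
  fix F :: "nat set" assume F: "finite F"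
  define k where "k = Max (insert 0 F)"
  have "(\<Sum>m\<in>F. real m powr - s) \<le> (\<Sum>m\<in>{0..Suc k}. real m powr - s)"
    using F by (intro sum_mono2) (auto simp: k_def intro!: le_SucI)
  also have "\<dots> = (\<Sum>m=1..Suc k. real m powr - s)"
    by (simp add: sum.atLeast_Suc_atMost)
  also have "\<dots> \<le> 1 + (1 - real (Suc k) powr (1 - s)) / (s - 1)" by (rule sum_powr_le[OF assms])
  also have "\<dots> \<le> 1 + 1 / (s - 1)"
    using assms by (intro add_left_mono divide_right_mono) auto
  finally show "(\<Sum>m\<in>F. real m powr - s) \<le> 1 + 1 / (s - 1)" .
qed

text \<open>Since \<open>n powr (s - r) = (\<Sum>d | d dvd n. jordan (s - r) d)\<close>, the series with exponent \<open>r\<close>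
  is the series with exponent \<open>s\<close> convolved with nonnegative coefficients, and convolution
  only moves mass into a set that is closed under multiples.\<close>

lemma zsum_ratio_antimono:
  assumes rs: "1 < r" "r < s"
    and M: "\<And>m e. m \<in> M \<Longrightarrow> e > 0 \<Longrightarrow> m * e \<in> M"
  shows "zsum s M * zsum r UNIV \<le> zsum r M * zsum s UNIV"
proof -
  define t where "t = s - r"
  have t: "t > 0" using rs by (simp add: t_def)
  \<comment> \<open>Without 0 every set of divisors is finite, and (n, d) corresponds bijectively to
    the factorization of n as d times n div d.\<close>
  define P where "P = {0::nat<..}"
  define a where "a d = jordan t d * real d powr - s" for d
  define f where "f = (\<lambda>(d, e). a d * real e powr - s)"
  \<comment> \<open>This is zeta(r) / zeta(s), kept as a series until \<open>total\<close>
    identifies it.\<close>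
  define G where "G = (\<Sum>\<^sub>\<infinity>d\<in>P. a d)"
  have zP: "zsum u N = (\<Sum>\<^sub>\<infinity>m\<in>N \<inter> P. real m powr - u)" for u N
    unfolding zsum_def P_def by (intro infsum_cong_neutral) auto
  have a0: "a d \<ge> 0" for d using jordan_bounds(1)[of t d] t by (simp add: a_def)
  have a1: "a d \<le> real d powr - r" for d
  proof -
    have "a d \<le> real d powr t * real d powr - s"
      using jordan_bounds(2)[of t d] t by (simp add: a_def mult_right_mono)
    then show ?thesis by (simp add: powr_add[symmetric] t_def)
  qed
  have asum: "a summable_on P"
    by (rule summable_on_comparison_test[OF powr_summable_on[OF rs(1)]]) (use a0 a1 in auto)
  have esum: "(\<lambda>e. real e powr - s) summable_on N" for N
    using rs by (intro powr_summable_on) auto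
  have f0: "f z \<ge> 0" for z using a0 by (auto simp: f_def split: prod.splits)
  have prod: "f summable_on P \<times> N" "infsum f (P \<times> N) = G * (\<Sum>\<^sub>\<infinity>e\<in>N. real e powr - s)" for N
  proof -
    have hs: "((\<lambda>e. f (d, e)) has_sum a d * (\<Sum>\<^sub>\<infinity>e\<in>N. real e powr - s)) N" for d
      unfolding f_def by (simp add: has_sum_cmult_right esum)
    show sm: "f summable_on P \<times> N"
      by (rule summable_on_SigmaI[OF hs]) (use asum f0 in \<open>auto intro: summable_on_cmult_left\<close>)
    have "infsum f (P \<times> N) = (\<Sum>\<^sub>\<infinity>d\<in>P. \<Sum>\<^sub>\<infinity>e\<in>N. f (d, e))"
      by (rule infsum_Sigma_banach[OF sm, symmetric])
    also have "\<dots> = (\<Sum>\<^sub>\<infinity>d\<in>P. a d * (\<Sum>\<^sub>\<infinity>e\<in>N. real e powr - s))"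
      using hs by (intro infsum_cong infsumI) auto
    also have "\<dots> = G * (\<Sum>\<^sub>\<infinity>e\<in>N. real e powr - s)"
      unfolding G_def by (rule infsum_cmult_left')
    finally show "infsum f (P \<times> N) = G * (\<Sum>\<^sub>\<infinity>e\<in>N. real e powr - s)" .
  qed
  have conv: "zsum r N = infsum f {(d, e). d \<in> P \<and> e \<in> P \<and> d * e \<in> N}" for N
  proof -
    let ?X = "{(d, e). d \<in> P \<and> e \<in> P \<and> d * e \<in> N}"
    let ?Y = "SIGMA n:N \<inter> P. {d. d dvd n}"
    let ?g = "\<lambda>(n::nat, d::nat). (d, n div d)"
    have bij: "bij_betw ?g ?Y ?X"
      by (rule bij_betw_byWitness[where f' = "\<lambda>(d, e). (d * e, d)"])
         (auto simp: P_def intro!: Nat.gr0I)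
    have X: "f summable_on ?X"
      by (rule summable_on_subset_banach[OF prod(1)[of P]]) auto
    have Y: "(\<lambda>z. f (?g z)) summable_on ?Y"
      using summable_on_reindex_bij_betw[OF bij, of f] X by simp
    have "infsum f ?X = infsum (\<lambda>z. f (?g z)) ?Y"
      using infsum_reindex_bij_betw[OF bij, of f] by simp
    also have "\<dots> = (\<Sum>\<^sub>\<infinity>n\<in>N \<inter> P. \<Sum>\<^sub>\<infinity>d\<in>{d. d dvd n}. f (?g (n, d)))"
      by (rule infsum_Sigma_banach[OF Y, symmetric])
    also have "\<dots> = (\<Sum>\<^sub>\<infinity>n\<in>N \<inter> P. real n powr - r)"
    proof (rule infsum_cong)
      fix n assume n: "n \<in> N \<inter> P"
      then have n0: "n > 0" by (simp add: P_def)
      have "(\<Sum>\<^sub>\<infinity>d\<in>{d. d dvd n}. f (?g (n, d))) = (\<Sum>d | d dvd n. f (?g (n, d)))"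
        using n0 by (intro infsum_finite) auto
      also have "\<dots> = (\<Sum>d | d dvd n. jordan t d * real n powr - s)"
      proof (rule sum.cong[OF refl])
        fix d assume "d \<in> {d. d dvd n}"
        then obtain e where e: "n = d * e" by auto
        then show "f (?g (n, d)) = jordan t d * real n powr - s"
          using n0 by (simp add: f_def a_def powr_mult)
      qed
      also have "\<dots> = real n powr t * real n powr - s"
        by (simp add: sum_distrib_right[symmetric] jordan_divisor_sum[OF n0])
      also have "\<dots> = real n powr - r" by (simp add: powr_add[symmetric] t_def)
      finally show "(\<Sum>\<^sub>\<infinity>d\<in>{d. d dvd n}. f (?g (n, d))) = real n powr - r" .
    qed
    finally show ?thesis by (simp add: zP)
  qed
  have "zsum r UNIV = infsum f (P \<times> P)"
    unfolding conv[of UNIV] by (rule infsum_cong_neutral) auto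
  also have "\<dots> = G * zsum s UNIV" unfolding prod(2) by (simp add: zP)
  finally have total: "zsum r UNIV = G * zsum s UNIV" .
  have "G * zsum s M = infsum f (P \<times> (M \<inter> P))" unfolding prod(2) by (simp add: zP)
  also have "\<dots> \<le> infsum f {(d, e). d \<in> P \<and> e \<in> P \<and> d * e \<in> M}"
  proof (rule infsum_mono2[OF prod(1)])
    show "f summable_on {(d, e). d \<in> P \<and> e \<in> P \<and> d * e \<in> M}"
      by (rule summable_on_subset_banach[OF prod(1)[of P]]) auto
    show "P \<times> (M \<inter> P) \<subseteq> {(d, e). d \<in> P \<and> e \<in> P \<and> d * e \<in> M}"
      using M by (auto simp: P_def) (metis mult.commute)
  qed (use f0 in auto)
  also have "\<dots> = zsum r M" by (simp add: conv)
  finally have "G * zsum s M \<le> zsum r M" .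
  then have "G * zsum s M * zsum s UNIV \<le> zsum r M * zsum s UNIV"
    by (intro mult_right_mono zsum_nonneg)
  then show ?thesis unfolding total by (simp add: mult_ac)
qed

subsection \<open>The Davenport--Erdos theorem\<close>

definition lsum :: "nat set \<Rightarrow> real \<Rightarrow> real" where
  "lsum E y = (\<Sum>m | m > 0 \<and> real m \<le> y \<and> m \<in> E. 1 / real m)"

lemma finite_nat_real_le: "finite {m. real m \<le> y \<and> Q m}"
proof (rule finite_subset)
  show "{m. real m \<le> y \<and> Q m} \<subseteq> {..nat \<lfloor>y\<rfloor>}" by (auto simp: le_nat_floor)
qed simp

lemma lsum_mono:
  assumes "E \<subseteq> F" "y \<le> z"
  shows "lsum E y \<le> lsum F z"
  unfolding lsum_def using finite_nat_real_le[of z "\<lambda>m. m > 0 \<and> m \<in> F"] assms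
  by (intro sum_mono2) (auto simp: conj_ac)

lemma lsum_nonneg: "lsum E y \<ge> 0"
  unfolding lsum_def by (intro sum_nonneg) auto

text \<open>Lowering the exponent from \<open>s\<close> to 1 multiplies each term by
  \<open>m powr (1 / ln y)\<close>, which is at most e for m <= y; 3 is e rounded up.\<close>

lemma lsum_le_zsum:
  assumes "y > 1"
  shows "lsum E y \<le> 3 * zsum (1 + 1 / ln y) E"
proof -
  define s where "s = 1 + 1 / ln y"
  have l: "ln y > 0" using assms by simp
  have fin: "finite {m. m > 0 \<and> real m \<le> y \<and> m \<in> E}"
    using finite_nat_real_le[of y "\<lambda>m. m > 0 \<and> m \<in> E"] by (simp add: conj_ac)
  have "lsum E y \<le> (\<Sum>m | m > 0 \<and> real m \<le> y \<and> m \<in> E. 3 * real m powr - s)"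
    unfolding lsum_def
  proof (rule sum_mono)
    fix m assume "m \<in> {m. m > 0 \<and> real m \<le> y \<and> m \<in> E}"
    then have m: "m > 0" "real m \<le> y" by auto
    have "ln (real m) / ln y \<le> 1" using m l assms by (simp add: divide_le_eq)
    then have "real m powr (1 / ln y) \<le> exp 1" using m by (simp add: powr_def)
    also have "exp 1 \<le> (3::real)" by (rule exp_le)
    finally have "real m powr (1 / ln y) * real m powr - s \<le> 3 * real m powr - s"
      by (rule mult_right_mono) simp
    moreover have "real m powr (1 / ln y) * real m powr - s = 1 / real m"
      using m by (simp add: powr_add[symmetric] s_def powr_minus_divide)
    ultimately show "1 / real m \<le> 3 * real m powr - s" by simp
  qed
  also have "\<dots> = 3 * (\<Sum>m | m > 0 \<and> real m \<le> y \<and> m \<in> E. real m powr - s)"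
    by (simp add: sum_distrib_left)
  also have "\<dots> \<le> 3 * zsum s E"
    unfolding zsum_def using l fin
    by (intro mult_left_mono finite_sum_le_infsum powr_summable_on) (auto simp: s_def)
  finally show ?thesis by (simp add: s_def)
qed

text \<open>Upper logarithmic density at most \<open>\<epsilon>\<close>, in a slightly sharpened
  form: the additive constant makes the bound valid for every \<open>y\<close> from 1 on, so it can
  be used at any cutoff depending on \<open>x\<close>.\<close>

definition thin :: "real \<Rightarrow> nat set \<Rightarrow> bool" where
  "thin \<epsilon> E \<longleftrightarrow> (\<exists>C\<ge>0. \<forall>y\<ge>1. lsum E y \<le> \<epsilon> * ln y + C)"

lemma thin_subset: "thin \<epsilon> F \<Longrightarrow> E \<subseteq> F \<Longrightarrow> thin \<epsilon> E"
  unfolding thin_def by (meson lsum_mono order.refl order_trans)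

lemma multiples_mult: "m \<in> multiples A \<Longrightarrow> e > 0 \<Longrightarrow> m * e \<in> multiples A"
  unfolding multiples_def by (auto intro: dvd_mult2)

lemma multiples_mono: "A \<subseteq> B \<Longrightarrow> multiples A \<subseteq> multiples B"
  by (auto simp: multiples_def)

text \<open>The Davenport--Erdos theorem. By monotonicity of the zeta ratio, a truncation that is good
  at one exponent \<open>s\<^sub>0\<close> is good at all exponents closer to 1; Rankin's trick at
  \<open>1 + 1 / ln y\<close> then bounds the logarithmic sum.\<close>

lemma thin_multiples_tail:
  assumes "\<epsilon> > 0"
  shows "\<exists>k. thin \<epsilon> (multiples A - multiples (A \<inter> {..k}))"
proof -
  \<comment> \<open>The loss is 2 \<delta> in the zeta ratio, and \<open>lsum_le_zsum\<close>
    multiplies it by 3.\<close>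
  define \<delta> where "\<delta> = \<epsilon> / 6"
  have \<delta>: "\<delta> > 0" using assms by (simp add: \<delta>_def)
  define P where "P N s = zsum s N / zsum s UNIV" for N s
  define M where "M = multiples A"
  \<comment> \<open>By \<open>zsum_ratio_antimono\<close> this is also the limit of the ratio as s
    tends to 1 from above; as a supremum it only needs boundedness.\<close>
  define D where "D = (SUP s\<in>{1<..}. P M s)"
  have bdd: "bdd_above (P M ` {1<..})"
    by (rule bdd_aboveI2[where M = 1])
       (auto simp: P_def divide_le_eq_1 zsum_pos intro!: zsum_mono)
  have PD: "P M s \<le> D" if "s > 1" for s
    unfolding D_def using that by (intro cSUP_upper bdd) auto
  have ne: "{1::real<..} \<noteq> {}" by (auto intro: gt_ex)
  obtain s0 where s0: "s0 > 1" "P M s0 > D - \<delta>"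
    using less_cSUP_iff[OF ne bdd, of "D - \<delta>"] \<delta> unfolding D_def[symmetric] by auto
  obtain F where F: "finite F" "F \<subseteq> M"
      "dist (\<Sum>m\<in>F. real m powr - s0) (zsum s0 M) \<le> \<delta> * zsum s0 UNIV"
    using infsum_finite_approximation[OF powr_summable_on[OF s0(1)], of "\<delta> * zsum s0 UNIV" M]
      \<delta> zsum_pos[OF s0(1)] unfolding zsum_def by (metis mult_pos_pos)
  \<comment> \<open>Each m in \<open>F\<close> has a divisor in \<open>A\<close>, which is at most m
    and hence at most \<open>k\<close>. So truncating \<open>A\<close> at \<open>k\<close> still
    captures all of \<open>F\<close>.\<close>
  define k where "k = Max (insert 0 F)"
  define Mk where "Mk = multiples (A \<inter> {..k})"
  have MkM: "Mk \<subseteq> M" unfolding Mk_def M_def by (intro multiples_mono) auto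
  have FMk: "F \<subseteq> Mk"
  proof
    fix m assume m: "m \<in> F"
    then have "m \<in> M" using F by auto
    then obtain a where a: "m > 0" "a \<in> A" "a dvd m" by (auto simp: M_def multiples_def)
    have "a \<le> k" using dvd_imp_le[OF a(3,1)] m F(1) unfolding k_def
      by (meson Max_ge finite_insert insertI2 order_trans)
    then show "m \<in> Mk" using a by (auto simp: Mk_def multiples_def)
  qed
  have "(\<Sum>m\<in>F. real m powr - s0) \<le> zsum s0 Mk"
    unfolding zsum_def using F FMk s0 by (intro finite_sum_le_infsum powr_summable_on) auto
  then have "zsum s0 M - \<delta> * zsum s0 UNIV \<le> zsum s0 Mk"
    using F(3) by (simp add: dist_real_def)
  then have "P M s0 - \<delta> \<le> P Mk s0"
    using zsum_pos[OF s0(1)]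
    by (simp add: P_def pos_le_divide_eq left_diff_distrib)
  then have k0: "P Mk s0 > D - 2 * \<delta>" using s0(2) by simp
  \<comment> \<open>One \<delta> was lost in choosing \<open>s0\<close>, the other in passing to the
    finite set \<open>F\<close>. As s decreases from \<open>s0\<close> the share of
    \<open>Mk\<close> only grows, while that of \<open>M\<close> stays below \<open>D\<close>, so
    the gap remains at most 2 \<delta>.\<close>
  have small: "zsum s (M - Mk) \<le> 2 * \<delta> * zsum s UNIV" if s: "1 < s" "s \<le> s0" for s
  proof -
    have "P Mk s0 \<le> P Mk s"
    proof (cases "s = s0")
      case False
      then have "zsum s0 Mk * zsum s UNIV \<le> zsum s Mk * zsum s0 UNIV"
        using s by (intro zsum_ratio_antimono) (auto simp: Mk_def multiples_mult)
      then show ?thesis using s s0 zsum_pos by (simp add: P_def frac_le_eq divide_simps mult_ac)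
    qed simp
    then have "P M s - P Mk s \<le> 2 * \<delta>" using PD[OF s(1)] k0 by linarith
    then have "zsum s M - zsum s Mk \<le> 2 * \<delta> * zsum s UNIV"
      using zsum_pos[OF s(1)] by (simp add: P_def diff_divide_distrib[symmetric] divide_le_eq)
    moreover have "(M - Mk) \<inter> Mk = {}" by blast
    then have "zsum s M = zsum s (M - Mk) + zsum s Mk"
      using infsum_Un_disjoint[OF powr_summable_on powr_summable_on, OF s(1) s(1), of "M - Mk" Mk]
        MkM by (simp add: zsum_def Un_absorb2)
    ultimately show ?thesis by simp
  qed
  \<comment> \<open>At \<open>y0\<close> the exponent 1 + 1 / ln y equals \<open>s0\<close>. Larger
    \<open>y\<close> fall in the range of \<open>small\<close>; smaller ones are absorbed by
    \<open>C\<close>.\<close>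
  define y0 where "y0 = exp (1 / (s0 - 1))"
  have y0: "y0 > 1" using s0 by (simp add: y0_def)
  define C where "C = \<epsilon> + lsum (M - Mk) y0"
  have "lsum (M - Mk) y \<le> \<epsilon> * ln y + C" if y: "y \<ge> 1" for y
  proof (cases "y \<le> y0")
    case True
    then have "lsum (M - Mk) y \<le> lsum (M - Mk) y0" by (intro lsum_mono) auto
    moreover have "\<epsilon> * ln y \<ge> 0" using y assms by simp
    ultimately show ?thesis using assms by (simp add: C_def)
  next
    case False
    then have y1: "y > 1" using y0 by simp
    have l: "ln y > 0" using y1 by simp
    have "1 / (s0 - 1) \<le> ln y"
      using False y0 y1 unfolding y0_def by (subst ln_ge_iff) auto
    then have le: "1 + 1 / ln y \<le> s0" using l s0 by (simp add: field_simps)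
    have "lsum (M - Mk) y \<le> 3 * zsum (1 + 1 / ln y) (M - Mk)" by (rule lsum_le_zsum[OF y1])
    also have "\<dots> \<le> 3 * (2 * \<delta> * zsum (1 + 1 / ln y) UNIV)"
      using small[OF _ le] l by simp
    also have "\<dots> \<le> 3 * (2 * \<delta> * (1 + 1 / ((1 + 1 / ln y) - 1)))"
      using \<delta> l by (intro mult_left_mono zsum_UNIV_le) auto
    also have "\<dots> = \<epsilon> * ln y + \<epsilon>" by (simp add: \<delta>_def algebra_simps)
    finally show ?thesis using lsum_nonneg[of "M - Mk" y0] by (simp add: C_def)
  qed
  moreover have "C \<ge> 0" using assms lsum_nonneg by (simp add: C_def)
  ultimately show ?thesis unfolding thin_def M_def Mk_def by blast
qed

subsection \<open>Weighted pairs and truncation\<close>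

definition wsum :: "(nat \<times> nat) set \<Rightarrow> (nat \<Rightarrow> nat \<Rightarrow> real) \<Rightarrow> real" where
  "wsum R g = (\<Sum>(m, n)\<in>R. g m n / (real m * real n))"

lemma wsum_mono:
  assumes "\<And>m n. (m, n) \<in> R \<Longrightarrow> g m n \<le> h m n"
  shows "wsum R g \<le> wsum R h"
  unfolding wsum_def using assms by (auto intro!: sum_mono divide_right_mono)

lemma wsum_nonneg: "(\<And>m n. (m, n) \<in> R \<Longrightarrow> g m n \<ge> 0) \<Longrightarrow> wsum R g \<ge> 0"
  unfolding wsum_def by (auto intro!: sum_nonneg divide_nonneg_nonneg)

lemma wsum_add: "wsum R (\<lambda>m n. g m n + h m n) = wsum R g + wsum R h"
  unfolding wsum_def sum.distrib[symmetric] by (rule sum.cong) (auto simp: add_divide_distrib)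

lemma wsum_diff: "wsum R (\<lambda>m n. g m n - h m n) = wsum R g - wsum R h"
  unfolding wsum_def sum_subtractf[symmetric] by (rule sum.cong) (auto simp: diff_divide_distrib)

lemma wsum_sum: "wsum R (\<lambda>m n. \<Sum>d\<in>D. g d m n) = (\<Sum>d\<in>D. wsum R (g d))"
  unfolding wsum_def by (subst sum.swap) (auto simp: sum_divide_distrib intro!: sum.cong)

lemma wsum_abs_le: "\<bar>wsum R g\<bar> \<le> wsum R (\<lambda>m n. \<bar>g m n\<bar>)"
  unfolding wsum_def by (rule order_trans[OF sum_abs]) (auto intro!: sum_mono)

text \<open>Each term is at most 1 / (d - 1) - 1 / d. The induction keeps the telescoped remainder;
  the bound is then independent of \<open>K\<close>.\<close>

lemma sum_inverse_squares_le:
  assumes "z \<ge> 1"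
  shows "(\<Sum>d\<in>{z<..K}. 1 / (real d)\<^sup>2) \<le> 1 / real z"
proof -
  have "(\<Sum>d\<in>{z<..z + k}. 1 / (real d)\<^sup>2) \<le> 1 / real z - 1 / real (z + k)" for k
  proof (induction k)
    case (Suc k)
    have "{z<..z + Suc k} = insert (z + Suc k) {z<..z + k}" by auto
    moreover have "1 / (real (z + Suc k))\<^sup>2 \<le> 1 / real (z + k) - 1 / real (z + Suc k)"
    proof -
      define a where "a = real (z + k)"
      have a: "a > 0" using assms by (simp add: a_def)
      have "1 / (a + 1)\<^sup>2 \<le> 1 / (a * (a + 1))"
        using a by (intro divide_left_mono) (auto simp: power2_eq_square intro!: mult_right_mono)
      also have "\<dots> = 1 / a - 1 / (a + 1)" using a by (simp add: field_simps)
      finally show ?thesis by (simp add: a_def algebra_simps)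
    qed
    ultimately show ?case using Suc by simp
  qed simp
  note * = this
  have "(\<Sum>d\<in>{z<..K}. 1 / (real d)\<^sup>2) \<le> (\<Sum>d\<in>{z<..z + K}. 1 / (real d)\<^sup>2)"
    by (intro sum_mono2) auto
  also have "\<dots> \<le> 1 / real z - 1 / real (z + K)" by (rule *)
  also have "\<dots> \<le> 1 / real z" by simp
  finally show ?thesis .
qed

text \<open>A Cauchy criterion for filters. It serves truncation arguments, where each precision has
  its own approximate limit: two approximate limits are close to each other because both are close
  to \<open>f x\<close> at a common \<open>x\<close>, which exists since the filter is
  proper.\<close>

lemma tendsto_if_eventually_near:
  fixes f :: "'a \<Rightarrow> real"
  assumes "F \<noteq> bot" and near: "\<And>e. e > 0 \<Longrightarrow> \<exists>l. \<forall>\<^sub>F x in F. \<bar>f x - l\<bar> \<le> e"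
  shows "\<exists>l. (f \<longlongrightarrow> l) F"
proof -
  have "\<forall>k::nat. \<exists>l. \<forall>\<^sub>F x in F. \<bar>f x - l\<bar> \<le> 1 / real (Suc k)"
    using near by simp
  then obtain l where l: "\<And>k::nat. \<forall>\<^sub>F x in F. \<bar>f x - l k\<bar> \<le> 1 / real (Suc k)" by metis
  have d: "\<bar>l j - l k\<bar> \<le> 1 / real (Suc j) + 1 / real (Suc k)" for j k
  proof -
    obtain x where "\<bar>f x - l j\<bar> \<le> 1 / real (Suc j)" "\<bar>f x - l k\<bar> \<le> 1 / real (Suc k)"
      using eventually_happens'[OF assms(1) eventually_conj[OF l[of j] l[of k]]] by auto
    then show ?thesis by linarith
  qed
  have "Cauchy l"
  proof (rule metric_CauchyI)
    fix e :: real assume e: "e > 0"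
    obtain M :: nat where M: "1 / real (Suc M) < e / 2"
      using nat_approx_posE[of "e / 2"] e by auto
    have "dist (l j) (l k) < e" if "j \<ge> M" "k \<ge> M" for j k
    proof -
      have "1 / real (Suc j) \<le> 1 / real (Suc M)" "1 / real (Suc k) \<le> 1 / real (Suc M)"
        using that by (auto intro!: divide_left_mono)
      then show ?thesis using d[of j k] M unfolding dist_real_def by linarith
    qed
    then show "\<exists>M. \<forall>m\<ge>M. \<forall>n\<ge>M. dist (l m) (l n) < e" by blast
  qed
  then obtain L where L: "l \<longlonglongrightarrow> L" using Cauchy_convergent convergent_def by blast
  have "(f \<longlongrightarrow> L) F"
  proof (rule tendstoI)
    fix e :: real assume e: "e > 0"
    have "\<forall>\<^sub>F k in sequentially. dist (l k) L < e / 2" using L e by (intro tendstoD) auto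
    moreover have "\<forall>\<^sub>F k in sequentially. 1 / real (Suc k) < e / 2"
      using LIMSEQ_inverse_real_of_nat e
      by (intro order_tendstoD(2)[where y = 0]) (auto simp: inverse_eq_divide)
    ultimately obtain k where k: "dist (l k) L < e / 2" "1 / real (Suc k) < e / 2"
      using eventually_happens'[OF sequentially_bot eventually_conj] by blast
    show "\<forall>\<^sub>F x in F. dist (f x) L < e"
      using l[of k]
    proof eventually_elim
      case (elim x)
      then show ?case using k unfolding dist_real_def by linarith
    qed
  qed
  then show ?thesis by blast
qed

section \<open>Coprime pairs over an abstract family of regions\<close>

text \<open>This is \<open>rat_multiples\<close> read on pairs. With \<open>{1}\<close>,
  \<open>{1}\<close> and 1 only coprimality remains for positive pairs, so numerator and denominator
  of the final quotient are instances of the same sum.\<close>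

definition admissible :: "nat set \<Rightarrow> nat set \<Rightarrow> nat \<Rightarrow> nat \<Rightarrow> nat \<Rightarrow> bool" where
  "admissible A B q m n \<longleftrightarrow>
     coprime m n \<and> m \<in> multiples A \<and> n \<in> multiples B \<and> coprime (m * n) q"

text \<open>The locale collects what the arithmetic needs, so that both kinds of intervals share one
  argument. In \<open>thin_num\<close> and \<open>thin_den\<close> the threshold is chosen before
  \<open>E\<close>: the exceptional set is a truncated tail whose truncation point depends on that
  threshold.\<close>

locale farey_regions =
  fixes Om :: "real \<Rightarrow> (nat \<times> nat) set"
  assumes finite_Om: "finite (Om x)"
    and pos_Om: "(m, n) \<in> Om x \<Longrightarrow> m > 0 \<and> n > 0"
    and scale_Om: "d > 0 \<Longrightarrow> (d * m, d * n) \<in> Om x \<Longrightarrow> (m, n) \<in> Om x"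
    and wsum_pos: "\<forall>\<^sub>F x in at_top. wsum (Om x) (\<lambda>m n. 1) > 0"
    and mean_value: "N > 0 \<Longrightarrow> (\<And>m n. g (m + N) n = g m n) \<Longrightarrow> (\<And>m n. g m (n + N) = g m n) \<Longrightarrow>
      (\<And>m n. \<bar>g m n\<bar> \<le> 1) \<Longrightarrow>
      \<exists>l. ((\<lambda>x. wsum (Om x) g / wsum (Om x) (\<lambda>m n. 1)) \<longlongrightarrow> l) at_top"
    and thin_num: "\<epsilon> > 0 \<Longrightarrow> \<exists>\<delta>>0. \<forall>E. thin \<delta> E \<longrightarrow>
      (\<forall>\<^sub>F x in at_top. wsum (Om x) (\<lambda>m n. of_bool (m \<in> E)) \<le> \<epsilon> * wsum (Om x) (\<lambda>m n. 1))"
    and thin_den: "\<epsilon> > 0 \<Longrightarrow> \<exists>\<delta>>0. \<forall>E. thin \<delta> E \<longrightarrow>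
      (\<forall>\<^sub>F x in at_top. wsum (Om x) (\<lambda>m n. of_bool (n \<in> E)) \<le> \<epsilon> * wsum (Om x) (\<lambda>m n. 1))"
begin

abbreviation W :: "real \<Rightarrow> real" where
  "W x \<equiv> wsum (Om x) (\<lambda>m n. 1)"

lemma wsum_common_divisor_le:
  assumes d: "d > 0"
  shows "wsum (Om x) (\<lambda>m n. of_bool (d dvd m \<and> d dvd n)) \<le> 1 / (real d)\<^sup>2 * W x"
proof -
  define T where "T = {(m, n). (d * m, d * n) \<in> Om x}"
  have TO: "T \<subseteq> Om x" using scale_Om[OF d] by (auto simp: T_def)
  have inj: "inj_on (\<lambda>(m, n). (d * m, d * n)) T" using d by (auto simp: inj_on_def)
  have im: "(\<lambda>(m, n). (d * m, d * n)) ` T = {(m, n) \<in> Om x. d dvd m \<and> d dvd n}"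
    by (auto simp: T_def image_iff elim!: dvdE)
  have "wsum (Om x) (\<lambda>m n. of_bool (d dvd m \<and> d dvd n))
      = (\<Sum>(m, n)\<in>(\<lambda>(m, n). (d * m, d * n)) ` T. 1 / (real m * real n))"
    unfolding wsum_def im using finite_Om by (intro sum.mono_neutral_cong_right) auto
  also have "\<dots> = (\<Sum>(m, n)\<in>T. 1 / (real d)\<^sup>2 * (1 / (real m * real n)))"
    by (subst sum.reindex[OF inj]) (auto simp: power2_eq_square intro!: sum.cong)
  also have "\<dots> \<le> (\<Sum>(m, n)\<in>Om x. 1 / (real d)\<^sup>2 * (1 / (real m * real n)))"
    using TO finite_Om by (intro sum_mono2) auto
  also have "\<dots> = 1 / (real d)\<^sup>2 * W x"
    unfolding wsum_def by (auto simp: sum_distrib_left intro!: sum.cong)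
  finally show ?thesis .
qed

lemma W_nonneg: "W x \<ge> 0"
  by (intro wsum_nonneg) auto

lemma wsum_gcd_gt_le:
  assumes z: "z \<ge> 1"
  shows "wsum (Om x) (\<lambda>m n. of_bool (gcd m n > z)) \<le> 1 / real z * W x"
proof -
  define K where "K = Max (insert 0 (fst ` Om x))"
  have K: "gcd m n \<le> K" if "(m, n) \<in> Om x" for m n
  proof -
    have "gcd m n \<le> m" using pos_Om[OF that] by (intro gcd_le1_nat) auto
    also have "m \<le> K" unfolding K_def using finite_Om that by (intro Max_ge) force+
    finally show ?thesis .
  qed
  have "wsum (Om x) (\<lambda>m n. of_bool (gcd m n > z))
      \<le> wsum (Om x) (\<lambda>m n. \<Sum>d\<in>{z<..K}. of_bool (d dvd m \<and> d dvd n))"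
  proof (rule wsum_mono)
    fix m n assume mn: "(m, n) \<in> Om x"
    show "of_bool (gcd m n > z) \<le> (\<Sum>d\<in>{z<..K}. of_bool (d dvd m \<and> d dvd n) :: real)"
    proof (cases "gcd m n > z")
      case True
      have "of_bool (gcd m n dvd m \<and> gcd m n dvd n)
          \<le> (\<Sum>d\<in>{z<..K}. of_bool (d dvd m \<and> d dvd n) :: real)"
        using True K[OF mn] by (intro member_le_sum) auto
      then show ?thesis using True by simp
    qed (auto intro: sum_nonneg)
  qed
  also have "\<dots> = (\<Sum>d\<in>{z<..K}. wsum (Om x) (\<lambda>m n. of_bool (d dvd m \<and> d dvd n)))"
    by (rule wsum_sum)
  also have "\<dots> \<le> (\<Sum>d\<in>{z<..K}. 1 / (real d)\<^sup>2 * W x)"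
    by (intro sum_mono wsum_common_divisor_le) auto
  also have "\<dots> = (\<Sum>d\<in>{z<..K}. 1 / (real d)\<^sup>2) * W x" by (simp add: sum_distrib_right)
  also have "\<dots> \<le> 1 / real z * W x"
    by (intro mult_right_mono sum_inverse_squares_le z W_nonneg)
  finally show ?thesis .
qed

text \<open>The common divisor 2 costs at most 1 / 4 of the weight and a gcd above 2 at most 1 / 2.
  The value 2 is treated separately because the tail bound of \<open>wsum_gcd_gt_le\<close> at 1
  would leave nothing.\<close>

lemma wsum_coprime_ge: "wsum (Om x) (\<lambda>m n. of_bool (coprime m n)) \<ge> W x / 4"
proof -
  have "W x \<le> wsum (Om x) (\<lambda>m n. of_bool (coprime m n) +
      (of_bool (2 dvd m \<and> 2 dvd n) + of_bool (gcd m n > 2)))"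
  proof (rule wsum_mono)
    fix m n assume "(m, n) \<in> Om x"
    then have "gcd m n > 0" using pos_Om by auto
    then consider "gcd m n = 1" | "gcd m n = 2" | "gcd m n > 2" by linarith
    then show "1 \<le> of_bool (coprime m n) + (of_bool (2 dvd m \<and> 2 dvd n) + of_bool (gcd m n > 2) :: real)"
    proof cases
      case 2
      then have "2 dvd m" "2 dvd n" using gcd_dvd1[of m n] gcd_dvd2[of m n] by auto
      then show ?thesis by simp
    qed (auto simp: coprime_iff_gcd_eq_1)
  qed
  also have "\<dots> = wsum (Om x) (\<lambda>m n. of_bool (coprime m n)) +
      (wsum (Om x) (\<lambda>m n. of_bool (2 dvd m \<and> 2 dvd n)) + wsum (Om x) (\<lambda>m n. of_bool (gcd m n > 2)))"
    by (simp only: wsum_add)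
  finally show ?thesis
    using wsum_common_divisor_le[of 2 x] wsum_gcd_gt_le[of 2 x] by simp
qed

text \<open>Truncating \<open>A\<close>, \<open>B\<close> and the set of excluded common divisors at \<open>z\<close> gives a condition that
  is periodic modulo \<open>fact z * q\<close>.\<close>

lemma admissible_mean:
  assumes q: "q > 0"
  shows "\<exists>l. ((\<lambda>x. wsum (Om x) (\<lambda>m n. of_bool (admissible A B q m n)) / W x) \<longlongrightarrow> l) at_top"
proof (rule tendsto_if_eventually_near)
  fix e :: real assume e: "e > 0"
  \<comment> \<open>Three shares go to the truncations of \<open>A\<close>, of \<open>B\<close> and
    of the common divisors, the fourth to the convergence of the periodic mean.\<close>
  define \<epsilon> where "\<epsilon> = e / 4"
  have \<epsilon>: "\<epsilon> > 0" using e by (simp add: \<epsilon>_def)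
  obtain \<delta>1 where d1: "\<delta>1 > 0" "\<And>E. thin \<delta>1 E \<Longrightarrow>
      \<forall>\<^sub>F x in at_top. wsum (Om x) (\<lambda>m n. of_bool (m \<in> E)) \<le> \<epsilon> * W x"
    using thin_num[OF \<epsilon>] by blast
  obtain \<delta>2 where d2: "\<delta>2 > 0" "\<And>E. thin \<delta>2 E \<Longrightarrow>
      \<forall>\<^sub>F x in at_top. wsum (Om x) (\<lambda>m n. of_bool (n \<in> E)) \<le> \<epsilon> * W x"
    using thin_den[OF \<epsilon>] by blast
  obtain k1 where k1: "thin \<delta>1 (multiples A - multiples (A \<inter> {..k1}))"
    using thin_multiples_tail[OF d1(1)] by blast
  obtain k2 where k2: "thin \<delta>2 (multiples B - multiples (B \<inter> {..k2}))"
    using thin_multiples_tail[OF d2(1)] by blast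
  obtain k3 :: nat where k3: "1 / real (Suc k3) < \<epsilon>" using nat_approx_posE[OF \<epsilon>] by auto
  define z where "z = max (max k1 k2) (Suc k3)"
  have z: "z \<ge> 1" "1 / real z \<le> \<epsilon>"
  proof -
    show "z \<ge> 1" by (simp add: z_def)
    have "1 / real z \<le> 1 / real (Suc k3)" by (intro divide_left_mono) (auto simp: z_def)
    then show "1 / real z \<le> \<epsilon>" using k3 by simp
  qed
  define E1 where "E1 = multiples A - multiples (A \<inter> {..z})"
  define E2 where "E2 = multiples B - multiples (B \<inter> {..z})"
  have "E1 \<subseteq> multiples A - multiples (A \<inter> {..k1})"
    unfolding E1_def by (intro Diff_mono multiples_mono) (auto simp: z_def)
  then have E1: "\<forall>\<^sub>F x in at_top. wsum (Om x) (\<lambda>m n. of_bool (m \<in> E1)) \<le> \<epsilon> * W x"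
    by (intro d1(2) thin_subset[OF k1])
  have "E2 \<subseteq> multiples B - multiples (B \<inter> {..k2})"
    unfolding E2_def by (intro Diff_mono multiples_mono) (auto simp: z_def)
  then have E2: "\<forall>\<^sub>F x in at_top. wsum (Om x) (\<lambda>m n. of_bool (n \<in> E2)) \<le> \<epsilon> * W x"
    by (intro d2(2) thin_subset[OF k2])
  define N where "N = fact z * q"
  have N: "N > 0" using q by (simp add: N_def)
  \<comment> \<open>Zero is left out of the truncated sets, since divisibility by 0 is not periodic;
    m and n are positive, so nothing is lost. Coprimality of the product with \<open>q\<close> is
    split into two conditions, each periodic in its own variable.\<close>
  define Q where "Q m n \<longleftrightarrow> (\<forall>d\<in>{2..z}. \<not> (d dvd m \<and> d dvd n)) \<and> (\<exists>a\<in>A \<inter> {0<..z}. a dvd m) \<and>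
      (\<exists>b\<in>B \<inter> {0<..z}. b dvd n) \<and> coprime m q \<and> coprime n q" for m n
  have dN: "d dvd m + N \<longleftrightarrow> d dvd m" if "d > 0" "d \<le> z" for d m
  proof -
    have "d dvd N" using that by (simp add: N_def dvd_fact)
    then show ?thesis by (simp add: dvd_add_left_iff)
  qed
  have qN: "coprime (m + N) q \<longleftrightarrow> coprime m q" for m
  proof -
    have "gcd (m + N) q = gcd m q"
      unfolding N_def by (metis gcd.commute gcd_add_mult add.commute mult.commute)
    then show ?thesis by (simp add: coprime_iff_gcd_eq_1)
  qed
  have per1: "Q (m + N) n = Q m n" for m n unfolding Q_def using qN dN by auto
  have per2: "Q m (n + N) = Q m n" for m n unfolding Q_def using qN dN by auto
  define g where "g m n = (of_bool (Q m n) :: real)" for m n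
  obtain l where l: "((\<lambda>x. wsum (Om x) g / W x) \<longlongrightarrow> l) at_top"
    using mean_value[OF N, of g] per1 per2 by (auto simp: g_def)
  define h where "h m n = (of_bool (admissible A B q m n) :: real)" for m n
  \<comment> \<open>The two indicators differ in two ways. If \<open>Q\<close> holds without
    admissibility, a common divisor above \<open>z\<close> was missed; if a pair is admissible
    without \<open>Q\<close>, then m or n owes its membership to large divisors only.\<close>
  have hg: "\<bar>h m n - g m n\<bar> \<le> of_bool (m \<in> E1) + (of_bool (n \<in> E2) + of_bool (gcd m n > z))"
    if "(m, n) \<in> Om x" for m n x
  proof -
    have mn: "m > 0" "n > 0" using pos_Om[OF that] by auto
    show ?thesis
    proof (cases "Q m n")
      case True
      have "admissible A B q m n" if "\<not> gcd m n > z"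
      proof -
        have "gcd m n > 0" using mn by simp
        have "gcd m n \<notin> {2..z}" using True unfolding Q_def by (metis gcd_dvd1 gcd_dvd2)
        then have "gcd m n = 1"
          using that \<open>gcd m n > 0\<close> unfolding atLeastAtMost_iff by linarith
        then have "coprime m n" by (simp add: coprime_iff_gcd_eq_1)
        then show ?thesis using True mn unfolding admissible_def Q_def multiples_def by auto
      qed
      then show ?thesis using True by (auto simp: h_def g_def)
    next
      case False
      have "m \<in> E1 \<or> n \<in> E2" if ad: "admissible A B q m n"
      proof (rule ccontr)
        assume "\<not> (m \<in> E1 \<or> n \<in> E2)"
        then have "m \<in> multiples (A \<inter> {..z})" "n \<in> multiples (B \<inter> {..z})"
          using ad by (auto simp: admissible_def E1_def E2_def)
        then obtain a b where ab: "a \<in> A" "a \<le> z" "a dvd m" "b \<in> B" "b \<le> z" "b dvd n"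
          by (auto simp: multiples_def)
        have "a > 0" "b > 0" using ab mn by (auto intro!: Nat.gr0I)
        moreover have "\<not> (d dvd m \<and> d dvd n)" if "d \<in> {2..z}" for d
        proof
          assume "d dvd m \<and> d dvd n"
          then have "is_unit d"
            using ad coprime_common_divisor[of m n d] by (simp add: admissible_def)
          then show False using that by simp
        qed
        ultimately have "Q m n" using ab ad unfolding Q_def admissible_def by auto
        then show False using False by simp
      qed
      then show ?thesis using False by (auto simp: h_def g_def)
    qed
  qed
  have "\<forall>\<^sub>F x in at_top. \<bar>wsum (Om x) h / W x - l\<bar> \<le> e"
    using E1 E2 wsum_pos tendstoD[OF l \<epsilon>]
  proof eventually_elim
    case (elim x)
    have "\<bar>wsum (Om x) h - wsum (Om x) g\<bar> = \<bar>wsum (Om x) (\<lambda>m n. h m n - g m n)\<bar>"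
      by (simp add: wsum_diff)
    also have "\<dots> \<le> wsum (Om x) (\<lambda>m n. \<bar>h m n - g m n\<bar>)" by (rule wsum_abs_le)
    also have "\<dots> \<le> wsum (Om x)
        (\<lambda>m n. of_bool (m \<in> E1) + (of_bool (n \<in> E2) + of_bool (gcd m n > z)))"
      by (intro wsum_mono hg)
    also have "\<dots> \<le> \<epsilon> * W x + (\<epsilon> * W x + \<epsilon> * W x)"
      unfolding wsum_add using elim(1,2) wsum_gcd_gt_le[OF z(1), of x] z(2) elim(3)
        mult_right_mono[OF z(2), of "W x"] by linarith
    finally have "\<bar>wsum (Om x) h - wsum (Om x) g\<bar> \<le> 3 * \<epsilon> * W x" by simp
    then have "\<bar>wsum (Om x) h / W x - wsum (Om x) g / W x\<bar> \<le> 3 * \<epsilon>"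
      using elim(3) by (simp add: diff_divide_distrib[symmetric] divide_le_eq)
    then show ?case using elim(4) unfolding dist_real_def \<epsilon>_def by linarith
  qed
  then show "\<exists>l. \<forall>\<^sub>F x in at_top.
      \<bar>wsum (Om x) (\<lambda>m n. of_bool (admissible A B q m n)) / W x - l\<bar> \<le> e"
    unfolding h_def by blast
qed simp

lemma admissible_ratio:
  assumes q: "q > 0"
  shows "\<exists>l. ((\<lambda>x. wsum (Om x) (\<lambda>m n. of_bool (admissible A B q m n)) /
    wsum (Om x) (\<lambda>m n. of_bool (admissible {1} {1} 1 m n))) \<longlongrightarrow> l) at_top"
proof -
  let ?p = "\<lambda>x. wsum (Om x) (\<lambda>m n. of_bool (admissible A B q m n))"
  let ?r = "\<lambda>x. wsum (Om x) (\<lambda>m n. of_bool (admissible {1} {1} 1 m n))"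
  obtain l1 where l1: "((\<lambda>x. ?p x / W x) \<longlongrightarrow> l1) at_top" using admissible_mean[OF q] by blast
  obtain l2 where l2: "((\<lambda>x. ?r x / W x) \<longlongrightarrow> l2) at_top"
    using admissible_mean[of 1] by auto
  have "\<forall>\<^sub>F x in at_top. 1 / 4 \<le> ?r x / W x"
    using wsum_pos
  proof eventually_elim
    case (elim x)
    have "W x / 4 \<le> wsum (Om x) (\<lambda>m n. of_bool (coprime m n))" by (rule wsum_coprime_ge)
    also have "\<dots> \<le> ?r x"
      using pos_Om by (intro wsum_mono) (auto simp: admissible_def multiples_def)
    finally show ?case using elim by (simp add: le_divide_eq)
  qed
  then have "1 / 4 \<le> l2" by (rule tendsto_lowerbound[OF l2]) simp
  then have "((\<lambda>x. (?p x / W x) / (?r x / W x)) \<longlongrightarrow> l1 / l2) at_top"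
    using l1 l2 by (intro tendsto_divide) auto
  moreover have "\<forall>\<^sub>F x in at_top. (?p x / W x) / (?r x / W x) = ?p x / ?r x"
    using wsum_pos by eventually_elim simp
  ultimately show ?thesis using tendsto_cong by (intro exI[of _ "l1 / l2"]) fast
qed

end

subsection \<open>Mean values of periodic conditions\<close>

lemma periodic_sum_shift:
  fixes h :: "nat \<Rightarrow> real"
  assumes "\<And>m. h (m + N) = h m"
  shows "(\<Sum>m\<in>{a..<a + N}. h m) = (\<Sum>m<N. h m)"
proof (induction a)
  case 0
  then show ?case by (simp add: lessThan_atLeast0)
next
  case (Suc a)
  have "(\<Sum>m\<in>{a..<a + N}. h m) + h (a + N) = (\<Sum>m\<in>{a..<Suc (a + N)}. h m)" by simp
  also have "\<dots> = h a + (\<Sum>m\<in>{Suc a..<Suc (a + N)}. h m)"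
    by (rule sum.atLeast_Suc_lessThan) simp
  finally show ?case using Suc assms by simp
qed

text \<open>Full periods cancel, so only the fewer than \<open>N\<close> leftover terms
  count.\<close>

lemma periodic_partial_sum_le:
  fixes h :: "nat \<Rightarrow> real"
  assumes "N > 0" and per: "\<And>m. h (m + N) = h m" and zero: "(\<Sum>m<N. h m) = 0"
    and bd: "\<And>m. \<bar>h m\<bar> \<le> c"
  shows "\<bar>\<Sum>m\<in>{a..<a + k}. h m\<bar> \<le> real N * c"
proof (induction k arbitrary: a rule: less_induct)
  case (less k)
  have c: "c \<ge> 0" using bd[of 0] by simp
  show ?case
  proof (cases "k < N")
    case True
    have "\<bar>\<Sum>m\<in>{a..<a + k}. h m\<bar> \<le> (\<Sum>m\<in>{a..<a + k}. \<bar>h m\<bar>)" by (rule sum_abs)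
    also have "\<dots> \<le> (\<Sum>m\<in>{a..<a + k}. c)" by (intro sum_mono bd)
    also have "\<dots> = real k * c" by simp
    also have "\<dots> \<le> real N * c" using True c by (intro mult_right_mono) auto
    finally show ?thesis .
  next
    case False
    then have "(\<Sum>m\<in>{a..<a + k}. h m) = (\<Sum>m\<in>{a..<a + N}. h m) + (\<Sum>m\<in>{a + N..<a + k}. h m)"
      by (intro sum.atLeastLessThan_concat[symmetric]) auto
    also have "\<dots> = (\<Sum>m\<in>{a + N..<(a + N) + (k - N)}. h m)"
      using periodic_sum_shift[of h N a, OF per] zero False by simp
    finally show ?thesis using less.IH[of "k - N" "a + N"] False assms(1) by simp
  qed
qed

text \<open>Summation by parts with decreasing weights: the boundary term contributes
  \<open>K * w k\<close> and the differences telescope to \<open>K * (w 0 - w k)\<close>, so the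
  total does not depend on the length.\<close>

lemma abel_inverse_sum_le:
  fixes h :: "nat \<Rightarrow> real"
  assumes a: "a > 0" and K: "\<And>k. \<bar>\<Sum>m\<in>{a..<a + k}. h m\<bar> \<le> K"
  shows "\<bar>\<Sum>m\<in>{a..<a + k}. h m / real m\<bar> \<le> K / real a"
proof -
  define H where "H k = (\<Sum>m\<in>{a..<a + k}. h m)" for k
  define w where "w k = 1 / real (a + k)" for k
  have mono: "w (Suc i) \<le> w i" for i
    using a by (simp add: w_def divide_left_mono)
  have id: "(\<Sum>m\<in>{a..<a + k}. h m / real m) = H k * w k + (\<Sum>i<k. H (Suc i) * (w i - w (Suc i)))" for k
  proof (induction k)
    case 0
    then show ?case by (simp add: H_def)
  next
    case (Suc k)
    have "h (a + k) = H (Suc k) - H k" by (simp add: H_def)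
    then have "(\<Sum>m\<in>{a..<a + Suc k}. h m / real m)
       = H k * w k + (\<Sum>i<k. H (Suc i) * (w i - w (Suc i))) + (H (Suc k) - H k) * w k"
      using Suc by (simp add: w_def)
    then show ?case by (simp add: algebra_simps)
  qed
  have "\<bar>\<Sum>m\<in>{a..<a + k}. h m / real m\<bar> \<le> K * w k + (\<Sum>i<k. K * (w i - w (Suc i)))"
  proof -
    have "\<bar>H k * w k\<bar> \<le> K * w k"
      using K[of k] by (simp add: abs_mult H_def w_def mult_right_mono divide_right_mono)
    moreover have "\<bar>\<Sum>i<k. H (Suc i) * (w i - w (Suc i))\<bar> \<le> (\<Sum>i<k. K * (w i - w (Suc i)))"
    proof (rule order_trans[OF sum_abs], rule sum_mono)
      fix i
      show "\<bar>H (Suc i) * (w i - w (Suc i))\<bar> \<le> K * (w i - w (Suc i))"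
        unfolding abs_mult using K[of "Suc i"] mono[of i]
        by (intro mult_mono) (auto simp: H_def)
    qed
    ultimately show ?thesis unfolding id by linarith
  qed
  also have "\<dots> = K * (w k + (\<Sum>i<k. w i - w (Suc i)))"
    by (simp add: sum_distrib_left distrib_left)
  also have "(\<Sum>i<k. w i - w (Suc i)) = w 0 - w k"
    using sum_lessThan_telescope'[of w k] by simp
  finally show ?thesis by (simp add: w_def)
qed

text \<open>A nonempty finite set of this kind is an integer interval, so rows and columns can be
  handled without computing their endpoints.\<close>

definition order_convex :: "nat set \<Rightarrow> bool" where
  "order_convex J \<longleftrightarrow> (\<forall>i\<in>J. \<forall>k\<in>J. \<forall>j. i \<le> j \<and> j \<le> k \<longrightarrow> j \<in> J)"

text \<open>Abel summation yields the reciprocal of the least element. Any common bound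
  \<open>u\<close> of the reciprocals replaces it, so empty slices need no special treatment
  later.\<close>

lemma periodic_inverse_sum_le:
  fixes h :: "nat \<Rightarrow> real"
  assumes J: "finite J" "order_convex J" "0 \<notin> J"
    and u: "u \<ge> 0" "\<And>m. m \<in> J \<Longrightarrow> 1 / real m \<le> u"
    and h: "N > 0" "\<And>m. h (m + N) = h m" "(\<Sum>m<N. h m) = 0" "\<And>m. \<bar>h m\<bar> \<le> c"
  shows "\<bar>\<Sum>m\<in>J. h m / real m\<bar> \<le> real N * c * u"
proof -
  have c: "c \<ge> 0" using h(4)[of 0] by simp
  show ?thesis
  proof (cases "J = {}")
    case True
    then show ?thesis using c u by simp
  next
    case False
    define a where "a = Min J"
    define k where "k = Suc (Max J) - a"
    have a: "a \<in> J" using False J by (simp add: a_def)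
    then have a0: "a > 0" using J(3) by (metis gr0I)
    have le: "a \<le> Max J" using a J by simp
    have "J = {a..<a + k}"
    proof (intro equalityI subsetI)
      fix j assume "j \<in> J"
      then show "j \<in> {a..<a + k}" using J le by (auto simp: a_def k_def less_Suc_eq_le)
    next
      fix j assume "j \<in> {a..<a + k}"
      then have "a \<le> j" "j \<le> Max J" using le by (auto simp: k_def)
      then show "j \<in> J" using J(2) a Max_in[OF J(1) False] unfolding order_convex_def by blast
    qed
    then have "\<bar>\<Sum>m\<in>J. h m / real m\<bar> \<le> (real N * c) / real a"
      using abel_inverse_sum_le[OF a0, of h "real N * c" k] periodic_partial_sum_le[OF h] by metis
    also have "\<dots> = real N * c * (1 / real a)" by simp
    also have "\<dots> \<le> real N * c * u" using u(2)[OF a] c by (intro mult_left_mono) auto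
    finally show ?thesis .
  qed
qed

lemma finite_slices:
  assumes "finite R"
  shows "finite {m. (m, n) \<in> R}" "finite {n. (m, n) \<in> R}"
proof -
  have "{m. (m, n) \<in> R} \<subseteq> fst ` R" "{n. (m, n) \<in> R} \<subseteq> snd ` R" by force+
  then show "finite {m. (m, n) \<in> R}" "finite {n. (m, n) \<in> R}"
    using assms by (auto intro: finite_subset)
qed

lemma sum_slices:
  assumes fin: "finite R" "finite K"
  shows "(\<And>m n. (m, n) \<in> R \<Longrightarrow> n \<in> K) \<Longrightarrow>
      (\<Sum>(m, n)\<in>R. f m n) = (\<Sum>n\<in>K. \<Sum>m | (m, n) \<in> R. f m n)"
    and "(\<And>m n. (m, n) \<in> R \<Longrightarrow> m \<in> K) \<Longrightarrow>
      (\<Sum>(m, n)\<in>R. f m n) = (\<Sum>m\<in>K. \<Sum>n | (m, n) \<in> R. f m n)"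
proof -
  assume K: "\<And>m n. (m, n) \<in> R \<Longrightarrow> n \<in> K"
  have "(\<Sum>n\<in>K. \<Sum>m | (m, n) \<in> R. f m n) = (\<Sum>(n, m)\<in>(SIGMA n:K. {m. (m, n) \<in> R}). f m n)"
    using fin finite_slices by (intro sum.Sigma) auto
  also have "\<dots> = (\<Sum>(m, n)\<in>R. f m n)"
    using K by (intro sum.reindex_bij_witness[of _ prod.swap prod.swap]) auto
  finally show "(\<Sum>(m, n)\<in>R. f m n) = (\<Sum>n\<in>K. \<Sum>m | (m, n) \<in> R. f m n)" by simp
next
  assume K: "\<And>m n. (m, n) \<in> R \<Longrightarrow> m \<in> K"
  have "(\<Sum>m\<in>K. \<Sum>n | (m, n) \<in> R. f m n) = (\<Sum>(m, n)\<in>(SIGMA m:K. {n. (m, n) \<in> R}). f m n)"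
    using fin finite_slices by (intro sum.Sigma) auto
  also have "(SIGMA m:K. {n. (m, n) \<in> R}) = R" using K by auto
  finally show "(\<Sum>(m, n)\<in>R. f m n) = (\<Sum>m\<in>K. \<Sum>n | (m, n) \<in> R. f m n)" by simp
qed

text \<open>The Abel summation error is governed by the largest reciprocal in each row and column.\<close>

definition slice_error :: "(nat \<times> nat) set \<Rightarrow> real \<Rightarrow> bool" where
  "slice_error R e \<longleftrightarrow> (\<exists>M K u v. finite M \<and> finite K \<and> R \<subseteq> M \<times> K \<and>
     (\<forall>n. u n \<ge> 0) \<and> (\<forall>m. v m \<ge> 0) \<and>
     (\<forall>(m, n)\<in>R. 1 / real m \<le> u n \<and> 1 / real n \<le> v m) \<and>
     (\<Sum>n\<in>K. u n / real n) + (\<Sum>m\<in>M. v m / real m) \<le> e)"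

lemma slice_errorI:
  assumes "finite M" "finite K" "R \<subseteq> M \<times> K" "\<And>n. u n \<ge> 0" "\<And>m. v m \<ge> 0"
    "\<And>m n. (m, n) \<in> R \<Longrightarrow> 1 / real m \<le> u n" "\<And>m n. (m, n) \<in> R \<Longrightarrow> 1 / real n \<le> v m"
    "(\<Sum>n\<in>K. u n / real n) + (\<Sum>m\<in>M. v m / real m) \<le> e"
  shows "slice_error R e"
  unfolding slice_error_def
  by (rule exI[of _ M], rule exI[of _ K], rule exI[of _ u], rule exI[of _ v]) (use assms in auto)

lemma abs_mean_le:
  fixes f :: "nat \<Rightarrow> real"
  assumes "N > 0" "\<And>i. \<bar>f i\<bar> \<le> 1"
  shows "\<bar>(\<Sum>i<N. f i) / real N\<bar> \<le> 1"
proof -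
  have "\<bar>\<Sum>i<N. f i\<bar> \<le> (\<Sum>i<N. \<bar>f i\<bar>)" by (rule sum_abs)
  also have "\<dots> \<le> (\<Sum>i<N. 1)" by (intro sum_mono assms)
  finally show ?thesis using assms(1) by simp
qed

text \<open>The average is taken one variable at a time: \<open>g\<close> is replaced by its row
  mean \<open>p n\<close>, then \<open>p\<close> by its mean \<open>l\<close>. Both differences have
  mean zero over a period and size at most 2, so Abel summation applies along rows first and along
  columns second.\<close>

lemma periodic_wsum_error:
  assumes R: "finite R" "\<And>m n. (m, n) \<in> R \<Longrightarrow> m > 0 \<and> n > 0"
    and conv: "\<And>n. order_convex {m. (m, n) \<in> R}" "\<And>m. order_convex {n. (m, n) \<in> R}"
    and err: "slice_error R e"
    and N: "N > 0" and g: "\<And>m n. g (m + N) n = g m n" "\<And>m n. g m (n + N) = g m n"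
      "\<And>m n. \<bar>g m n\<bar> \<le> (1 :: real)"
  shows "\<bar>wsum R g - (\<Sum>j<N. (\<Sum>i<N. g i j) / real N) / real N * wsum R (\<lambda>m n. 1)\<bar>
    \<le> real N * 2 * e"
proof -
  obtain M K u v where E: "finite M" "finite K" "R \<subseteq> M \<times> K" "\<forall>n. u n \<ge> 0" "\<forall>m. v m \<ge> 0"
      "\<forall>(m, n)\<in>R. 1 / real m \<le> u n \<and> 1 / real n \<le> v m"
      "(\<Sum>n\<in>K. u n / real n) + (\<Sum>m\<in>M. v m / real m) \<le> e"
    using err unfolding slice_error_def by (elim exE conjE) (rule that; assumption)
  have uv: "1 / real m \<le> u n" "1 / real n \<le> v m" if "(m, n) \<in> R" for m n
    using E(6) that by auto
  define p where "p n = (\<Sum>i<N. g i n) / real N" for n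
  define l where "l = (\<Sum>j<N. p j) / real N"
  have p1: "\<bar>p n\<bar> \<le> 1" for n unfolding p_def by (intro abs_mean_le N g)
  have l1: "\<bar>l\<bar> \<le> 1" unfolding l_def by (intro abs_mean_le N p1)
  have pN: "p (n + N) = p n" for n by (simp add: p_def g)
  have 1: "\<bar>wsum R (\<lambda>m n. g m n - p n)\<bar> \<le> (\<Sum>n\<in>K. real N * 2 * (u n / real n))"
  proof -
    have "wsum R (\<lambda>m n. g m n - p n) = (\<Sum>n\<in>K. \<Sum>m | (m, n) \<in> R. (g m n - p n) / (real m * real n))"
      unfolding wsum_def using E by (intro sum_slices R) auto
    also have "\<dots> = (\<Sum>n\<in>K. (\<Sum>m | (m, n) \<in> R. (g m n - p n) / real m) / real n)"
      by (simp add: sum_divide_distrib)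
    finally have "\<bar>wsum R (\<lambda>m n. g m n - p n)\<bar>
        \<le> (\<Sum>n\<in>K. \<bar>(\<Sum>m | (m, n) \<in> R. (g m n - p n) / real m) / real n\<bar>)"
      by (simp only: sum_abs)
    also have "\<dots> \<le> (\<Sum>n\<in>K. real N * 2 * (u n / real n))"
    proof (rule sum_mono)
      fix n
      have "\<bar>\<Sum>m | (m, n) \<in> R. (g m n - p n) / real m\<bar> \<le> real N * 2 * u n"
      proof (rule periodic_inverse_sum_le[OF _ conv(1) _ E(4)[rule_format] _ N])
        show "(\<Sum>m<N. g m n - p n) = 0" using N by (simp add: sum_subtractf p_def)
        show "\<bar>g m n - p n\<bar> \<le> 2" for m using g(3)[of m n] p1[of n] by linarith
      qed (use R uv g finite_slices in auto)
      then show "\<bar>(\<Sum>m | (m, n) \<in> R. (g m n - p n) / real m) / real n\<bar>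
          \<le> real N * 2 * (u n / real n)"
        using divide_right_mono[of _ _ "real n"] by (simp add: abs_divide)
    qed
    finally show ?thesis .
  qed
  have 2: "\<bar>wsum R (\<lambda>m n. p n - l)\<bar> \<le> (\<Sum>m\<in>M. real N * 2 * (v m / real m))"
  proof -
    have "wsum R (\<lambda>m n. p n - l) = (\<Sum>m\<in>M. \<Sum>n | (m, n) \<in> R. (p n - l) / (real m * real n))"
      unfolding wsum_def using E by (intro sum_slices R) auto
    also have "\<dots> = (\<Sum>m\<in>M. (\<Sum>n | (m, n) \<in> R. (p n - l) / real n) / real m)"
      by (simp add: sum_divide_distrib mult.commute)
    finally have "\<bar>wsum R (\<lambda>m n. p n - l)\<bar>
        \<le> (\<Sum>m\<in>M. \<bar>(\<Sum>n | (m, n) \<in> R. (p n - l) / real n) / real m\<bar>)"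
      by (simp only: sum_abs)
    also have "\<dots> \<le> (\<Sum>m\<in>M. real N * 2 * (v m / real m))"
    proof (rule sum_mono)
      fix m
      have "\<bar>\<Sum>n | (m, n) \<in> R. (p n - l) / real n\<bar> \<le> real N * 2 * v m"
      proof (rule periodic_inverse_sum_le[OF _ conv(2) _ E(5)[rule_format] _ N])
        show "(\<Sum>n<N. p n - l) = 0" using N by (simp add: sum_subtractf l_def)
        show "\<bar>p n - l\<bar> \<le> 2" for n using p1[of n] l1 by linarith
      qed (use R uv pN finite_slices in auto)
      then show "\<bar>(\<Sum>n | (m, n) \<in> R. (p n - l) / real n) / real m\<bar>
          \<le> real N * 2 * (v m / real m)"
        using divide_right_mono[of _ _ "real m"] by (simp add: abs_divide)
    qed
    finally show ?thesis .
  qed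
  have "wsum R g - l * wsum R (\<lambda>m n. 1) = wsum R (\<lambda>m n. g m n - p n) + wsum R (\<lambda>m n. p n - l)"
  proof -
    have "wsum R (\<lambda>m n. l) = l * wsum R (\<lambda>m n. 1)"
      unfolding wsum_def by (auto simp: sum_distrib_left intro!: sum.cong)
    then show ?thesis by (simp add: wsum_diff)
  qed
  also have "\<bar>\<dots>\<bar> \<le> real N * 2 * ((\<Sum>n\<in>K. u n / real n) + (\<Sum>m\<in>M. v m / real m))"
    using 1 2 unfolding sum_distrib_left[symmetric] distrib_left by linarith
  also have "\<dots> \<le> real N * 2 * e" using E(7) by (intro mult_left_mono) auto
  finally show ?thesis by (simp add: l_def p_def)
qed

section \<open>Integer points of a truncated sector\<close>

definition region :: "real \<Rightarrow> real \<Rightarrow> real \<Rightarrow> (nat \<times> nat) set" where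
  "region x a b = {(m, n). m > 0 \<and> n > 0 \<and> real n \<le> x \<and> a * real n < real m \<and> real m < b * real n}"

lemma region_le:
  assumes "(m, n) \<in> region x a b" "b \<ge> 0"
  shows "real m \<le> b * x"
proof -
  have "real m < b * real n" "real n \<le> x" using assms by (auto simp: region_def)
  then show ?thesis using mult_left_mono[of "real n" x b] assms(2) by linarith
qed

lemma finite_region: "finite (region x a b)"
proof (rule finite_subset)
  show "region x a b \<subseteq> {m. real m \<le> \<bar>b\<bar> * x \<and> True} \<times> {n. real n \<le> x \<and> True}"
  proof (clarsimp simp: region_def)
    fix m n assume "real n \<le> x" "real m < b * real n"
    moreover have "b * real n \<le> \<bar>b\<bar> * x"
      using \<open>real n \<le> x\<close> by (intro mult_mono) auto
    ultimately show "real m \<le> \<bar>b\<bar> * x" by linarith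
  qed
qed (intro finite_cartesian_product finite_nat_real_le)

lemma region_scale:
  assumes "d > 0" "(d * m, d * n) \<in> region x a b"
  shows "(m, n) \<in> region x a b"
proof -
  have dn: "real (d * n) \<le> x" and s: "a * real (d * n) < real (d * m)" "real (d * m) < b * real (d * n)"
    and p: "m > 0" "n > 0"
    using assms by (auto simp: region_def)
  have "real d * (a * real n) < real d * real m" "real d * real m < real d * (b * real n)"
    using s by (simp_all add: mult_ac)
  then have "a * real n < real m" "real m < b * real n" using assms(1) by simp_all
  moreover have "n \<le> d * n" using assms(1) by simp
  then have "real n \<le> real (d * n)" by (simp only: of_nat_le_iff)
  then have "real n \<le> x" using dn by linarith
  ultimately show ?thesis using p by (simp add: region_def)
qed

lemma order_convex_region:
  assumes "a \<ge> 0" "b \<ge> 0"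
  shows "order_convex {m. (m, n) \<in> region x a b}" "order_convex {n. (m, n) \<in> region x a b}"
proof -
  show "order_convex {m. (m, n) \<in> region x a b}" by (auto simp: order_convex_def region_def)
  show "order_convex {n. (m, n) \<in> region x a b}"
    unfolding order_convex_def
  proof (intro ballI allI impI)
    fix i k j assume *: "i \<in> {n. (m, n) \<in> region x a b}" "k \<in> {n. (m, n) \<in> region x a b}" "i \<le> j \<and> j \<le> k"
    have "a * real j \<le> a * real k" "b * real i \<le> b * real j"
      using * assms by (auto intro!: mult_left_mono)
    then show "j \<in> {n. (m, n) \<in> region x a b}" using * by (auto simp: region_def)
  qed
qed

lemma farey_regionsI:
  assumes ab: "\<forall>\<^sub>F x in at_top. 0 \<le> a x \<and> a x < b x"
    and W: "\<forall>\<^sub>F x in at_top. wsum (region x (a x) (b x)) (\<lambda>m n. 1) > 0"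
    and err: "\<And>\<epsilon>. \<epsilon> > 0 \<Longrightarrow> \<forall>\<^sub>F x in at_top.
      slice_error (region x (a x) (b x)) (\<epsilon> * wsum (region x (a x) (b x)) (\<lambda>m n. 1))"
    and num: "\<And>\<epsilon>. \<epsilon> > 0 \<Longrightarrow> \<exists>\<delta>>0. \<forall>E. thin \<delta> E \<longrightarrow> (\<forall>\<^sub>F x in at_top.
      wsum (region x (a x) (b x)) (\<lambda>m n. of_bool (m \<in> E))
        \<le> \<epsilon> * wsum (region x (a x) (b x)) (\<lambda>m n. 1))"
    and den: "\<And>\<epsilon>. \<epsilon> > 0 \<Longrightarrow> \<exists>\<delta>>0. \<forall>E. thin \<delta> E \<longrightarrow> (\<forall>\<^sub>F x in at_top.
      wsum (region x (a x) (b x)) (\<lambda>m n. of_bool (n \<in> E))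
        \<le> \<epsilon> * wsum (region x (a x) (b x)) (\<lambda>m n. 1))"
  shows "farey_regions (\<lambda>x. region x (a x) (b x))"
proof
  fix N :: nat and g :: "nat \<Rightarrow> nat \<Rightarrow> real"
  assume N: "N > 0" and g: "\<And>m n. g (m + N) n = g m n" "\<And>m n. g m (n + N) = g m n"
    "\<And>m n. \<bar>g m n\<bar> \<le> 1"
  define l where "l = (\<Sum>j<N. (\<Sum>i<N. g i j) / real N) / real N"
  let ?W = "\<lambda>x. wsum (region x (a x) (b x)) (\<lambda>m n. 1)"
  have "((\<lambda>x. wsum (region x (a x) (b x)) g / ?W x) \<longlongrightarrow> l) at_top"
  proof (rule tendstoI)
    fix e :: real assume e: "e > 0"
    \<comment> \<open>The factor \<open>real N * 2\<close> of \<open>periodic_wsum_error\<close>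
      then leaves e / 2.\<close>
    define \<epsilon> where "\<epsilon> = e / (4 * real N)"
    have \<epsilon>: "\<epsilon> > 0" using e N by (simp add: \<epsilon>_def)
    show "\<forall>\<^sub>F x in at_top. dist (wsum (region x (a x) (b x)) g / ?W x) l < e"
      using ab W err[OF \<epsilon>]
    proof eventually_elim
      case (elim x)
      have "\<bar>wsum (region x (a x) (b x)) g - l * ?W x\<bar> \<le> real N * 2 * (\<epsilon> * ?W x)"
        unfolding l_def using elim
        by (intro periodic_wsum_error finite_region order_convex_region g N)
           (auto simp: region_def)
      also have "\<dots> = e / 2 * ?W x" using N by (simp add: \<epsilon>_def)
      finally have "\<bar>wsum (region x (a x) (b x)) g - l * ?W x\<bar> / ?W x \<le> e / 2"
        using elim(2) by (simp add: divide_le_eq)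
      moreover have "wsum (region x (a x) (b x)) g / ?W x - l
          = (wsum (region x (a x) (b x)) g - l * ?W x) / ?W x"
        using elim(2) by (simp add: field_simps)
      ultimately have "\<bar>wsum (region x (a x) (b x)) g / ?W x - l\<bar> \<le> e / 2"
        using elim(2) by (simp only: abs_divide abs_of_pos)
      then show ?case using e unfolding dist_real_def by linarith
    qed
  qed
  then show "\<exists>l. ((\<lambda>x. wsum (region x (a x) (b x)) g / ?W x) \<longlongrightarrow> l) at_top" by blast
next
  show "\<And>x. finite (region x (a x) (b x))" by (rule finite_region)
  show "\<And>m n x. (m, n) \<in> region x (a x) (b x) \<Longrightarrow> 0 < m \<and> 0 < n" by (auto simp: region_def)
  show "\<And>d m n x. 0 < d \<Longrightarrow> (d * m, d * n) \<in> region x (a x) (b x) \<Longrightarrow> (m, n) \<in> region x (a x) (b x)"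
    by (rule region_scale)
qed (use W num den in auto)

subsection \<open>Intervals starting at zero\<close>

lemma sum_inverse_ge_ln:
  assumes "a > 0"
  shows "ln (real (a + k) / real a) \<le> (\<Sum>m\<in>{a..<a + k}. 1 / real m)"
proof (induction k)
  case 0
  then show ?case using assms by simp
next
  case (Suc k)
  have "ln (real (a + Suc k) / real a) = ln (real (a + k) / real a) + ln (real (Suc (a + k)) / real (a + k))"
    using assms by (simp add: ln_div)
  then show ?case using Suc inverse_Suc_le_ln(2)[of "a + k"] assms by simp
qed

lemma sum_inverse_le_ln:
  assumes "a > 0"
  shows "(\<Sum>m\<in>{a..a + k}. 1 / real m) \<le> 1 / real a + ln (real (a + k) / real a)"
proof (induction k)
  case 0
  then show ?case using assms by simp
next
  case (Suc k)
  have "ln (real (a + Suc k) / real a) = ln (real (a + k) / real a) + ln (real (Suc (a + k)) / real (a + k))"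
    using assms by (simp add: ln_div)
  then show ?case using Suc inverse_Suc_le_ln(1)[of "a + k"] assms by simp
qed

text \<open>The summand \<open>u\<close> pays for the first term. It is not fixed as 1 / \<alpha>
  because columns admit the better value \<open>min 1 (b / real m)\<close>.\<close>

lemma inverse_sum_le:
  assumes J: "finite J" "\<And>m. m \<in> J \<Longrightarrow> \<alpha> < real m \<and> real m < \<beta>"
    and \<alpha>: "0 < \<alpha>" "\<alpha> < \<beta>" and u: "u \<ge> 0" "\<And>m. m \<in> J \<Longrightarrow> 1 / real m \<le> u"
  shows "(\<Sum>m\<in>J. 1 / real m) \<le> u + ln (\<beta> / \<alpha>)"
proof (cases "J = {}")
  case True
  then show ?thesis using u \<alpha> by simp
next
  case False
  define a where "a = Min J"
  define k where "k = Max J - a"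
  have a: "a \<in> J" using J False by (simp add: a_def)
  have b: "Max J \<in> J" using J False by simp
  have "a \<le> Max J" using a J by simp
  then have ak: "a + k = Max J" by (simp add: k_def)
  have a0: "a > 0" using J(2)[OF a] \<alpha> by (auto intro!: Nat.gr0I)
  have "(\<Sum>m\<in>J. 1 / real m) \<le> (\<Sum>m\<in>{a..a + k}. 1 / real m)"
    unfolding ak using J by (intro sum_mono2) (auto simp: a_def)
  also have "\<dots> \<le> 1 / real a + ln (real (a + k) / real a)" by (rule sum_inverse_le_ln[OF a0])
  also have "\<dots> \<le> u + ln (\<beta> / \<alpha>)"
  proof (rule add_mono)
    have "real (a + k) / real a \<le> \<beta> / \<alpha>"
      unfolding ak using J(2)[OF a] J(2)[OF b] \<alpha> by (intro frac_le) auto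
    moreover have "real (a + k) / real a > 0" using a0 by simp
    ultimately show "ln (real (a + k) / real a) \<le> ln (\<beta> / \<alpha>)" by (intro ln_mono) auto
  qed (use u a in auto)
  finally show ?thesis .
qed

lemma inverse_sum_ge:
  assumes J: "finite J" "\<And>m. a \<le> m \<Longrightarrow> real m < \<beta> \<Longrightarrow> m \<in> J" and a: "a > 0" and \<beta>: "\<beta> > 0"
  shows "ln (\<beta> / real a) \<le> (\<Sum>m\<in>J. 1 / real m)"
proof (cases "\<beta> \<le> real a")
  case True
  then have "ln (\<beta> / real a) \<le> 0" using a \<beta> by simp
  also have "0 \<le> (\<Sum>m\<in>J. 1 / real m)" by (intro sum_nonneg) auto
  finally show ?thesis .
next
  case False
  define k where "k = nat \<lceil>\<beta>\<rceil> - a"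
  have ak: "a + k = nat \<lceil>\<beta>\<rceil>" using False unfolding k_def by linarith
  have "\<beta> \<le> real (a + k)" unfolding ak by linarith
  then have "ln (\<beta> / real a) \<le> ln (real (a + k) / real a)"
    using a \<beta> by (intro ln_mono divide_right_mono) auto
  also have "\<dots> \<le> (\<Sum>m\<in>{a..<a + k}. 1 / real m)" by (rule sum_inverse_ge_ln[OF a])
  also have "\<dots> \<le> (\<Sum>m\<in>J. 1 / real m)"
  proof (intro sum_mono2 J subsetI)
    fix m assume "m \<in> {a..<a + k}"
    then show "a \<le> m" "real m < \<beta>" unfolding ak by (simp, simp, linarith)
  qed auto
  finally show ?thesis .
qed

lemma finite_pos_nat_le: "finite {m. m > 0 \<and> real m \<le> y \<and> Q m}" "finite {m. m > 0 \<and> real m \<le> y}"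
  using finite_nat_real_le[of y "\<lambda>m. m > 0 \<and> Q m"] finite_nat_real_le[of y "\<lambda>m. m > 0"]
  by (simp_all add: conj_ac)

lemma lsum_UNIV: "lsum UNIV y = (\<Sum>m | m > 0 \<and> real m \<le> y. 1 / real m)"
  by (simp add: lsum_def)

lemma lsum_of_bool: "lsum E y = (\<Sum>m | m > 0 \<and> real m \<le> y. of_bool (m \<in> E) / real m)"
  unfolding lsum_def using finite_pos_nat_le(2)[of y]
  by (intro sum.mono_neutral_cong_left) auto

lemma lsum_UNIV_le:
  assumes "y \<ge> 1"
  shows "lsum UNIV y \<le> 1 + ln y"
proof -
  define k where "k = nat \<lfloor>y\<rfloor> - 1"
  have k: "1 + k = nat \<lfloor>y\<rfloor>" using assms unfolding k_def by linarith
  have "lsum UNIV y \<le> (\<Sum>m\<in>{1..1 + k}. 1 / real m)"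
    unfolding lsum_UNIV k by (intro sum_mono2) (auto simp: le_nat_floor)
  also have "\<dots> \<le> 1 / real 1 + ln (real (1 + k) / real 1)" by (intro sum_inverse_le_ln) auto
  also have "\<dots> \<le> 1 + ln y"
  proof -
    have "real (1 + k) \<le> y" unfolding k using assms by linarith
    then show ?thesis by (simp del: of_nat_add)
  qed
  finally show ?thesis .
qed

lemma lsum_UNIV_ge:
  assumes "y \<ge> 1"
  shows "ln y \<le> lsum UNIV y"
  using inverse_sum_ge[of "{m. m > 0 \<and> real m \<le> y}" 1 y] finite_pos_nat_le(2)[of y] assms
  unfolding lsum_UNIV by simp

section \<open>Product boxes and the zero case\<close>

lemma wsum_times:
  "wsum (M \<times> K) (\<lambda>m n. f m * g n) = (\<Sum>m\<in>M. f m / real m) * (\<Sum>n\<in>K. g n / real n)"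
  unfolding wsum_def sum_product sum.cartesian_product by (intro sum.cong) auto

lemma wsum_mono_set:
  assumes "finite S" "R \<subseteq> S" "\<And>m n. g m n \<ge> 0"
  shows "wsum R g \<le> wsum S g"
  unfolding wsum_def using assms by (intro sum_mono2) auto

lemma wsum_le_lsum_times:
  assumes "\<And>m n. (m, n) \<in> R \<Longrightarrow> m > 0 \<and> n > 0 \<and> real m \<le> y \<and> real n \<le> x"
  shows "wsum R (\<lambda>m n. of_bool (m \<in> E \<and> n \<in> F)) \<le> lsum E y * lsum F x"
proof -
  have "wsum R (\<lambda>m n. of_bool (m \<in> E \<and> n \<in> F))
    \<le> wsum ({m. m > 0 \<and> real m \<le> y} \<times> {n. n > 0 \<and> real n \<le> x}) (\<lambda>m n. of_bool (m \<in> E \<and> n \<in> F))"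
    using assms finite_pos_nat_le(2) by (intro wsum_mono_set) auto
  also have "\<dots> = wsum ({m. m > 0 \<and> real m \<le> y} \<times> {n. n > 0 \<and> real n \<le> x})
      (\<lambda>m n. of_bool (m \<in> E) * of_bool (n \<in> F))"
    by (simp add: of_bool_conj)
  also have "\<dots> = lsum E y * lsum F x" unfolding wsum_times lsum_of_bool ..
  finally show ?thesis .
qed


text \<open>The region contains the box of all m < exp (l / 2) and n between \<open>y\<close> and
  \<open>x\<close>, since \<kappa> <= l gives exp (l / 2) <= b y. Its sides have harmonic sums at
  least l / 2 and \<kappa> / 2 - ln 2; the ln 2 comes from rounding \<open>y\<close> up to an
  integer, and \<kappa> >= 4 absorbs it.\<close>

lemma region_zero_wsum_ge:
  assumes x: "x \<ge> 1" and b: "b > 0" and \<kappa>: "\<kappa> \<ge> 4" "\<kappa> \<le> ln x" "\<kappa> \<le> ln (b * x)"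
  shows "ln (b * x) * \<kappa> / 8 \<le> wsum (region x 0 b) (\<lambda>m n. 1)"
proof -
  define l where "l = ln (b * x)"
  define y where "y = x * exp (- \<kappa> / 2)"
  have bx: "b * x = exp l" using x b by (simp add: l_def)
  have xe: "x = exp (ln x)" using x by simp
  have y1: "y \<ge> 1"
  proof -
    have "y = exp (ln x - \<kappa> / 2)" unfolding y_def by (subst xe) (simp add: exp_add[symmetric])
    then show ?thesis using \<kappa> by simp
  qed
  define a where "a = nat \<lceil>y\<rceil>"
  have a: "a > 0" "real a \<le> 2 * y" "y \<le> real a" using y1 unfolding a_def by linarith+
  define K where "K = {n. n > 0 \<and> real n \<le> x \<and> a \<le> n}"
  define M where "M = {m. m > 0 \<and> real m < exp (l / 2)}"
  have fin: "finite K" "finite M"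
  proof -
    show "finite K" unfolding K_def by (rule finite_pos_nat_le)
    show "finite M" unfolding M_def
      by (rule finite_subset[OF _ finite_pos_nat_le(2)[of "exp (l / 2)"]]) auto
  qed
  have sub: "M \<times> K \<subseteq> region x 0 b"
  proof
    fix z assume "z \<in> M \<times> K"
    then obtain m n where z: "z = (m, n)" "m > 0" "real m < exp (l / 2)" "n > 0" "real n \<le> x" "a \<le> n"
      by (auto simp: M_def K_def)
    have "exp (l / 2) \<le> exp (l - \<kappa> / 2)" using \<kappa> by (simp add: l_def)
    also have "\<dots> = (b * x) * exp (- \<kappa> / 2)" unfolding bx exp_add[symmetric] by simp
    also have "\<dots> = b * y" by (simp add: y_def)
    also have "\<dots> \<le> b * real n" using z a b by (intro mult_left_mono) auto
    finally show "z \<in> region x 0 b" using z by (auto simp: region_def)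
  qed
  have 1: "l / 2 \<le> (\<Sum>m\<in>M. 1 / real m)"
    using inverse_sum_ge[OF fin(2), of 1 "exp (l / 2)"] by (simp add: M_def)
  have "\<kappa> / 4 \<le> \<kappa> / 2 - ln 2" using \<kappa> ln_2_less_1 by linarith
  also have "\<kappa> / 2 - ln 2 = ln (x / (2 * y))"
    using x by (simp add: y_def ln_div ln_mult)
  also have "\<dots> \<le> ln (x / real a)"
    using x a y1 by (intro ln_mono divide_left_mono) auto
  also have "\<dots> \<le> (\<Sum>n\<in>K. 1 / real n)"
    using a x by (intro inverse_sum_ge fin) (auto simp: K_def)
  finally have 2: "\<kappa> / 4 \<le> (\<Sum>n\<in>K. 1 / real n)" .
  have "l * \<kappa> / 8 = (l / 2) * (\<kappa> / 4)" by simp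
  also have "\<dots> \<le> (\<Sum>m\<in>M. 1 / real m) * (\<Sum>n\<in>K. 1 / real n)"
    using 1 2 \<kappa> by (intro mult_mono) (auto simp: l_def intro!: sum_nonneg)
  also have "\<dots> = wsum (M \<times> K) (\<lambda>m n. 1)" using wsum_times[of M K "\<lambda>_. 1" "\<lambda>_. 1"] by simp
  also have "\<dots> \<le> wsum (region x 0 b) (\<lambda>m n. 1)"
    by (intro wsum_mono_set finite_region sub) auto
  finally show ?thesis by (simp add: l_def)
qed

lemma farey_regions_zero:
  assumes b: "\<forall>x\<ge>1. b x > 0" and lim: "filterlim (\<lambda>x. b x * x) at_top at_top"
    and c1: "c\<^sub>1 > 0" "\<forall>\<^sub>F x in at_top. ln x / ln (b x * x) < c\<^sub>1"
  shows "farey_regions (\<lambda>x. region x 0 (b x))"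
proof -
  define c where "c = 1 / (8 * max 1 c\<^sub>1)"
  have c: "c > 0" by (simp add: c_def)
  define l where "l x = ln (b x * x)" for x
  let ?W = "\<lambda>x. wsum (region x 0 (b x)) (\<lambda>m n. 1)"
  have llim: "filterlim l at_top at_top"
    unfolding l_def by (rule filterlim_compose[OF ln_at_top lim])
  have large: "\<forall>\<^sub>F x in at_top. l x \<ge> T \<and> ln x \<ge> T \<and> x \<ge> 1 \<and> b x > 0 \<and> b x * x \<ge> 1" for T
  proof -
    have "\<forall>\<^sub>F x in at_top. l x \<ge> T" "\<forall>\<^sub>F x in at_top. ln x \<ge> T" "\<forall>\<^sub>F x in at_top. b x * x \<ge> 1"
      using llim ln_at_top lim by (auto simp: filterlim_at_top)
    then show ?thesis using eventually_ge_at_top[of 1] by eventually_elim (use b in auto)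
  qed
  have Wge: "\<forall>\<^sub>F x in at_top. ?W x \<ge> c * (l x * ln x)"
    using large[of "4 * max 1 c\<^sub>1"] c1(2)
  proof eventually_elim
    case (elim x)
    \<comment> \<open>The hypothesis on \<open>c\<^sub>1\<close> keeps this below
      \<open>l x\<close>, and the maximum with 1 keeps it below \<open>ln x\<close>. The total
      weight is thus at least a constant times \<open>l x * ln x\<close>.\<close>
    define \<kappa> where "\<kappa> = ln x / max 1 c\<^sub>1"
    have l0: "l x > 0" "ln x > 0" using elim by (smt (verit) max.cobounded1)+
    have "ln x \<le> c\<^sub>1 * l x" using elim l0 by (simp add: l_def divide_less_eq)
    also have "\<dots> \<le> max 1 c\<^sub>1 * l x" using l0 by (intro mult_right_mono) auto
    finally have k1: "\<kappa> \<le> l x" by (simp add: \<kappa>_def divide_le_eq mult.commute)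
    have k2: "\<kappa> \<le> ln x" unfolding \<kappa>_def using l0 by (simp add: divide_le_eq mult_le_cancel_left1)
    have k3: "\<kappa> \<ge> 4" unfolding \<kappa>_def using elim by (simp add: le_divide_eq mult.commute)
    have "l x * \<kappa> / 8 \<le> ?W x"
      unfolding l_def using elim k1 k2 k3 by (intro region_zero_wsum_ge) (auto simp: l_def)
    moreover have "l x * \<kappa> / 8 = c * (l x * ln x)" by (simp add: \<kappa>_def c_def)
    ultimately show ?case by simp
  qed
  \<comment> \<open>For large x both harmonic sums over \<open>UNIV\<close> lose a factor 2 by
    dropping the constant, and so does the thin sum; the product is at most 4 (\<epsilon> c / 4)
    \<open>l x * ln x\<close>.\<close>
  have thin: "\<forall>\<^sub>F x in at_top.
      lsum E (b x * x) * lsum UNIV x \<le> \<epsilon> * ?W x \<and> lsum UNIV (b x * x) * lsum E x \<le> \<epsilon> * ?W x"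
    if \<epsilon>: "\<epsilon> > 0" and E: "thin (\<epsilon> * c / 4) E" for \<epsilon> E
  proof -
    define \<delta> where "\<delta> = \<epsilon> * c / 4"
    have \<delta>: "\<delta> > 0" using \<epsilon> c by (simp add: \<delta>_def)
    obtain C where C: "C \<ge> 0" "\<And>y. y \<ge> 1 \<Longrightarrow> lsum E y \<le> \<delta> * ln y + C"
      using E unfolding thin_def \<delta>_def by blast
    show ?thesis using large[of "max 1 (C / \<delta>)"] Wge
    proof eventually_elim
      case (elim x)
      have L: "l x \<ge> 1" "ln x \<ge> 1" and "C / \<delta> \<le> l x" "C / \<delta> \<le> ln x" using elim by auto
      then have CL: "C \<le> \<delta> * l x" "C \<le> \<delta> * ln x" using \<delta> by (simp_all add: divide_le_eq mult.commute)
      have V: "4 * \<delta> * (l x * ln x) \<le> \<epsilon> * ?W x"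
        using mult_left_mono[OF elim(2), of \<epsilon>] \<epsilon> by (simp add: \<delta>_def mult_ac)
      have U: "lsum UNIV x \<le> 2 * ln x" "lsum UNIV (b x * x) \<le> 2 * l x"
        using lsum_UNIV_le[of x] lsum_UNIV_le[of "b x * x"] L elim by (auto simp: l_def)
      have X: "lsum E x \<le> 2 * \<delta> * ln x" "lsum E (b x * x) \<le> 2 * \<delta> * l x"
        using C(2)[of x] C(2)[of "b x * x"] CL elim by (auto simp: l_def)
      have "lsum E (b x * x) * lsum UNIV x \<le> (2 * \<delta> * l x) * (2 * ln x)"
        using U X L \<delta> by (intro mult_mono lsum_nonneg) auto
      moreover have "lsum UNIV (b x * x) * lsum E x \<le> (2 * l x) * (2 * \<delta> * ln x)"
        using U X L \<delta> by (intro mult_mono lsum_nonneg) auto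
      ultimately show ?case using V by (simp add: mult_ac)
    qed
  qed
  have reg: "m > 0 \<and> n > 0 \<and> real m \<le> b x * x \<and> real n \<le> x"
    if "(m, n) \<in> region x 0 (b x)" "b x > 0" for m n x
    using region_le[OF that(1)] that by (auto simp: region_def)
  show ?thesis
  proof (rule farey_regionsI)
    show "\<forall>\<^sub>F x in at_top. (0::real) \<le> 0 \<and> 0 < b x" using large[of 0] by eventually_elim simp
    show "\<forall>\<^sub>F x in at_top. ?W x > 0"
      using Wge large[of 1]
    proof eventually_elim
      case (elim x)
      then have "l x > 0" "ln x > 0" by linarith+
      then have "c * (l x * ln x) > 0" using c by (intro mult_pos_pos)
      then show ?case using elim(1) by linarith
    qed
    fix \<epsilon> :: real assume \<epsilon>: "\<epsilon> > 0"
    have T: "\<epsilon> * c / 4 > 0" using \<epsilon> c by simp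
    show "\<forall>\<^sub>F x in at_top. slice_error (region x 0 (b x)) (\<epsilon> * ?W x)"
      using large[of "max 1 (4 / (\<epsilon> * c))"] Wge
    proof eventually_elim
      case (elim x)
      have L: "l x \<ge> 1" "ln x \<ge> 1" and "4 / (\<epsilon> * c) \<le> l x" "4 / (\<epsilon> * c) \<le> ln x" using elim by auto
      then have "4 \<le> \<epsilon> * c * l x" "4 \<le> \<epsilon> * c * ln x" using \<epsilon> c by (simp_all add: divide_le_eq mult_ac)
      then have "4 * ln x \<le> \<epsilon> * c * l x * ln x" "4 * l x \<le> \<epsilon> * c * ln x * l x"
        using L by (auto intro!: mult_right_mono)
      then have "2 * ln x + 2 * l x \<le> \<epsilon> * (c * (l x * ln x))" by (simp add: mult_ac)
      also have "\<dots> \<le> \<epsilon> * ?W x" using elim(2) \<epsilon> by (intro mult_left_mono) auto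
      finally have e: "2 * ln x + 2 * l x \<le> \<epsilon> * ?W x" .
      \<comment> \<open>The trivial bound 1 for all reciprocals suffices: the error has size
        \<open>ln x + l x\<close> against a weight of order \<open>l x * ln x\<close>, and both
        factors tend to infinity.\<close>
      have "lsum UNIV x + lsum UNIV (b x * x) \<le> 2 * ln x + 2 * l x"
        using lsum_UNIV_le[of x] lsum_UNIV_le[of "b x * x"] L elim by (auto simp: l_def)
      then have s: "(\<Sum>n | n > 0 \<and> real n \<le> x. 1 / real n)
          + (\<Sum>m | m > 0 \<and> real m \<le> b x * x. 1 / real m) \<le> \<epsilon> * ?W x"
        using e unfolding lsum_UNIV by linarith
      show ?case
      proof (rule slice_errorI[OF finite_pos_nat_le(2) finite_pos_nat_le(2) _ _ _ _ _ s])
        show "region x 0 (b x) \<subseteq> {m. m > 0 \<and> real m \<le> b x * x} \<times> {n. n > 0 \<and> real n \<le> x}"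
          using reg[of _ _ x] elim by auto
      qed (auto simp: region_def divide_le_eq_1)
    qed
    show "\<exists>\<delta>>0. \<forall>E. thin \<delta> E \<longrightarrow>
      (\<forall>\<^sub>F x in at_top. wsum (region x 0 (b x)) (\<lambda>m n. of_bool (m \<in> E)) \<le> \<epsilon> * ?W x)"
    proof (intro exI[of _ "\<epsilon> * c / 4"] conjI T allI impI)
      fix E assume "thin (\<epsilon> * c / 4) E"
      from thin[OF \<epsilon> this] large[of 0]
      show "\<forall>\<^sub>F x in at_top. wsum (region x 0 (b x)) (\<lambda>m n. of_bool (m \<in> E)) \<le> \<epsilon> * ?W x"
      proof eventually_elim
        case (elim x)
        have "wsum (region x 0 (b x)) (\<lambda>m n. of_bool (m \<in> E \<and> n \<in> UNIV))
            \<le> lsum E (b x * x) * lsum UNIV x"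
          using reg elim by (intro wsum_le_lsum_times) blast
        then show ?case using elim by simp
      qed
    qed
    show "\<exists>\<delta>>0. \<forall>E. thin \<delta> E \<longrightarrow>
      (\<forall>\<^sub>F x in at_top. wsum (region x 0 (b x)) (\<lambda>m n. of_bool (n \<in> E)) \<le> \<epsilon> * ?W x)"
    proof (intro exI[of _ "\<epsilon> * c / 4"] conjI T allI impI)
      fix E assume "thin (\<epsilon> * c / 4) E"
      from thin[OF \<epsilon> this] large[of 0]
      show "\<forall>\<^sub>F x in at_top. wsum (region x 0 (b x)) (\<lambda>m n. of_bool (n \<in> E)) \<le> \<epsilon> * ?W x"
      proof eventually_elim
        case (elim x)
        have "wsum (region x 0 (b x)) (\<lambda>m n. of_bool (m \<in> UNIV \<and> n \<in> E))
            \<le> lsum UNIV (b x * x) * lsum E x"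
          using reg elim by (intro wsum_le_lsum_times) blast
        then show ?case using elim by simp
      qed
    qed
  qed
qed

subsection \<open>Intervals bounded away from zero\<close>

lemma sum_inverse_squares_le_2: "(\<Sum>n | n > 0 \<and> real n \<le> x. 1 / (real n)\<^sup>2) \<le> 2"
proof -
  define k where "k = nat \<lfloor>x\<rfloor>"
  have "(\<Sum>n | n > 0 \<and> real n \<le> x. 1 / (real n)\<^sup>2) \<le> (\<Sum>n\<in>insert 1 {1<..k}. 1 / (real n)\<^sup>2)"
    by (intro sum_mono2) (auto simp: k_def le_nat_floor)
  also have "\<dots> = 1 + (\<Sum>n\<in>{1<..k}. 1 / (real n)\<^sup>2)" by simp
  also have "\<dots> \<le> 1 + 1 / real 1" by (intro add_left_mono sum_inverse_squares_le) auto
  finally show ?thesis by simp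
qed

text \<open>Up to b + 2 the minimum is replaced by 1, giving a harmonic sum; beyond it the terms are
  at most b / m^2, with sum at most b / z <= 1.\<close>

lemma sum_min_inverse_le:
  assumes b: "b > 0" and M: "finite M" "0 \<notin> M"
  shows "(\<Sum>m\<in>M. min 1 (b / real m) / real m) \<le> 2 + ln (b + 2)"
proof -
  define z where "z = nat \<lfloor>b + 2\<rfloor>"
  have z: "z \<ge> 1" "real z \<le> b + 2" "b \<le> real z" using b unfolding z_def by linarith+
  define K where "K = Max (insert 0 M)"
  have "(\<Sum>m\<in>M. min 1 (b / real m) / real m)
      \<le> (\<Sum>m\<in>{m. m > 0 \<and> real m \<le> b + 2} \<union> {z<..K}. min 1 (b / real m) / real m)"
  proof (rule sum_mono2)
    show "M \<subseteq> {m. m > 0 \<and> real m \<le> b + 2} \<union> {z<..K}"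
    proof
      fix m assume m: "m \<in> M"
      then have "m > 0" "m \<le> K" using M by (auto simp: K_def intro!: Nat.gr0I)
      then show "m \<in> {m. m > 0 \<and> real m \<le> b + 2} \<union> {z<..K}"
        using z by (cases "m \<le> z") auto
    qed
  qed (use b finite_pos_nat_le(2) in auto)
  also have "\<dots> = (\<Sum>m | m > 0 \<and> real m \<le> b + 2. min 1 (b / real m) / real m)
      + (\<Sum>m\<in>{z<..K}. min 1 (b / real m) / real m)"
  proof (intro sum.union_disjoint finite_pos_nat_le)
    have "m \<le> z" if "real m \<le> b + 2" for m using that by (metis le_nat_floor z_def)
    then show "{m. m > 0 \<and> real m \<le> b + 2} \<inter> {z<..K} = {}" by fastforce
  qed auto
  also have "(\<Sum>m | m > 0 \<and> real m \<le> b + 2. min 1 (b / real m) / real m) \<le> lsum UNIV (b + 2)"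
    unfolding lsum_UNIV by (intro sum_mono divide_right_mono) auto
  also have "lsum UNIV (b + 2) \<le> 1 + ln (b + 2)" using b by (intro lsum_UNIV_le) auto
  also have "(\<Sum>m\<in>{z<..K}. min 1 (b / real m) / real m) \<le> (\<Sum>m\<in>{z<..K}. b * (1 / (real m)\<^sup>2))"
  proof (rule sum_mono)
    fix m
    have "min 1 (b / real m) / real m \<le> (b / real m) / real m" by (intro divide_right_mono) auto
    then show "min 1 (b / real m) / real m \<le> b * (1 / (real m)\<^sup>2)" by (simp add: power2_eq_square)
  qed
  also have "\<dots> = b * (\<Sum>m\<in>{z<..K}. 1 / (real m)\<^sup>2)" by (simp add: sum_distrib_left)
  also have "\<dots> \<le> b * (1 / real z)" using b by (intro mult_left_mono sum_inverse_squares_le z) auto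
  also have "\<dots> \<le> 1" using z b by simp
  finally show ?thesis by simp
qed

context
  fixes a b x :: real
  assumes ab: "0 < a" "a < b" and x: "x \<ge> 1"
begin

lemma ln_ratio_pos: "ln (b / a) > 0"
  using ab by simp

text \<open>The main term is the same in every row. The error, weighted by 1 / n, sums to at most 2
  / a over all rows because the series of inverse squares converges.\<close>

lemma region_num_slice:
  assumes n: "n > 0" "real n \<le> x"
  shows "ln (b / a) - 1 / (a * real n) \<le> (\<Sum>m | (m, n) \<in> region x a b. 1 / real m)"
    and "(\<Sum>m | (m, n) \<in> region x a b. 1 / real m) \<le> 1 / (a * real n) + ln (b / a)"
proof -
  have fin: "finite {m. (m, n) \<in> region x a b}" by (intro finite_slices finite_region)
  have an: "a * real n > 0" using ab n by simp
  have ratio: "(b * real n) / (a * real n) = b / a" using n by simp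
  \<comment> \<open>The least integer strictly above \<open>a * real n\<close>, as the interval is
    open.\<close>
  define k where "k = nat \<lfloor>a * real n\<rfloor> + 1"
  have k: "k > 0" "a * real n < real k" "real k \<le> a * real n + 1" using an unfolding k_def by linarith+
  have "ln (real k / (a * real n)) \<le> real k / (a * real n) - 1"
    using k an by (intro ln_le_minus_one) auto
  also have "\<dots> \<le> (a * real n + 1) / (a * real n) - 1"
    using k an by (intro diff_right_mono divide_right_mono) auto
  also have "\<dots> = 1 / (a * real n)" using ab n by (simp add: add_divide_distrib)
  finally have "ln (b / a) - 1 / (a * real n) \<le> ln (b / a) - ln (real k / (a * real n))" by simp
  also have "\<dots> = ln (b * real n / real k)"
    using ab n k by (simp add: ln_div ln_mult)
  also have "\<dots> \<le> (\<Sum>m | (m, n) \<in> region x a b. 1 / real m)"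
    using ab n k by (intro inverse_sum_ge fin) (auto simp: region_def)
  finally show "ln (b / a) - 1 / (a * real n) \<le> (\<Sum>m | (m, n) \<in> region x a b. 1 / real m)" .
  have "(\<Sum>m | (m, n) \<in> region x a b. 1 / real m) \<le> 1 / (a * real n) + ln ((b * real n) / (a * real n))"
    using an ab n by (intro inverse_sum_le fin) (auto simp: region_def intro!: divide_left_mono)
  then show "(\<Sum>m | (m, n) \<in> region x a b. 1 / real m) \<le> 1 / (a * real n) + ln (b / a)"
    unfolding ratio .
qed

lemma region_den_bound:
  assumes "(m, n) \<in> region x a b"
  shows "1 / real n \<le> min 1 (b / real m)" "1 / real m \<le> 1 / (a * real n)"
proof -
  have mn: "m > 0" "n > 0" "a * real n < real m" "real m < b * real n"
    using assms by (auto simp: region_def)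
  then show "1 / real n \<le> min 1 (b / real m)" by (simp add: field_simps)
  show "1 / real m \<le> 1 / (a * real n)" using mn ab by (intro divide_left_mono) auto
qed

text \<open>A column lies between m / b and m / a, with the same ratio b / a as the rows. The cutoff
  at \<open>x\<close> only shortens it, so there is an upper bound but no matching lower
  one.\<close>

lemma region_den_slice:
  assumes m: "m > 0"
  shows "(\<Sum>n | (m, n) \<in> region x a b. 1 / real n) \<le> min 1 (b / real m) + ln (b / a)"
proof -
  have "(\<Sum>n | (m, n) \<in> region x a b. 1 / real n)
      \<le> min 1 (b / real m) + ln ((real m / a) / (real m / b))"
  proof (rule inverse_sum_le)
    show "finite {n. (m, n) \<in> region x a b}" by (intro finite_slices finite_region)
    fix n assume "n \<in> {n. (m, n) \<in> region x a b}"
    then show "real m / b < real n \<and> real n < real m / a" "1 / real n \<le> min 1 (b / real m)"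
      using ab m region_den_bound(1)[of m n] by (auto simp: region_def field_simps)
  qed (use ab m in \<open>auto intro!: divide_strict_left_mono\<close>)
  also have "(real m / a) / (real m / b) = b / a" using m by simp
  finally show ?thesis .
qed

lemma region_wsum_ge: "ln (b / a) * ln x - 2 / a \<le> wsum (region x a b) (\<lambda>m n. 1)"
proof -
  let ?K = "{n. n > 0 \<and> real n \<le> x}"
  have "ln (b / a) * ln x \<le> ln (b / a) * lsum UNIV x"
    using ln_ratio_pos lsum_UNIV_ge[OF x] by (intro mult_left_mono) auto
  moreover have "1 / a * (\<Sum>n\<in>?K. 1 / (real n)\<^sup>2) \<le> 1 / a * 2"
    using ab sum_inverse_squares_le_2 by (intro mult_left_mono) auto
  ultimately have "ln (b / a) * ln x - 2 / a
      \<le> ln (b / a) * (\<Sum>n\<in>?K. 1 / real n) - 1 / a * (\<Sum>n\<in>?K. 1 / (real n)\<^sup>2)"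
    unfolding lsum_UNIV by simp
  also have "\<dots> = (\<Sum>n\<in>?K. (ln (b / a) - 1 / (a * real n)) / real n)"
    unfolding sum_distrib_left sum_subtractf[symmetric]
    by (intro sum.cong) (auto simp: power2_eq_square diff_divide_distrib)
  also have "\<dots> \<le> (\<Sum>n\<in>?K. (\<Sum>m | (m, n) \<in> region x a b. 1 / real m) / real n)"
    by (intro sum_mono divide_right_mono region_num_slice) auto
  also have "\<dots> = (\<Sum>n\<in>?K. \<Sum>m | (m, n) \<in> region x a b. 1 / (real m * real n))"
    by (simp add: sum_divide_distrib)
  also have "\<dots> = wsum (region x a b) (\<lambda>m n. 1)"
    unfolding wsum_def
    by (intro sum_slices(1)[symmetric] finite_region finite_pos_nat_le) (auto simp: region_def)
  finally show ?thesis .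
qed

lemma region_den_le:
  "wsum (region x a b) (\<lambda>m n. of_bool (n \<in> E)) \<le> ln (b / a) * lsum E x + 2 / a"
proof -
  let ?K = "{n. n > 0 \<and> real n \<le> x}"
  have "wsum (region x a b) (\<lambda>m n. of_bool (n \<in> E))
      = (\<Sum>n\<in>?K. \<Sum>m | (m, n) \<in> region x a b. of_bool (n \<in> E) / (real m * real n))"
    unfolding wsum_def
    by (intro sum_slices(1) finite_region finite_pos_nat_le) (auto simp: region_def)
  also have "\<dots> = (\<Sum>n\<in>?K. of_bool (n \<in> E) / real n * (\<Sum>m | (m, n) \<in> region x a b. 1 / real m))"
    by (simp add: sum_distrib_left mult.commute)
  also have "\<dots> \<le> (\<Sum>n\<in>?K. of_bool (n \<in> E) / real n * (1 / (a * real n) + ln (b / a)))"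
    by (intro sum_mono mult_left_mono region_num_slice) auto
  also have "\<dots> \<le> (\<Sum>n\<in>?K. 1 / a * (1 / (real n)\<^sup>2) + ln (b / a) * (of_bool (n \<in> E) / real n))"
    using ab by (intro sum_mono) (auto simp: power2_eq_square field_simps)
  also have "\<dots> = 1 / a * (\<Sum>n\<in>?K. 1 / (real n)\<^sup>2) + ln (b / a) * lsum E x"
    unfolding lsum_of_bool sum.distrib sum_distrib_left ..
  also have "\<dots> \<le> 1 / a * 2 + ln (b / a) * lsum E x"
    using ab by (intro add_right_mono mult_left_mono sum_inverse_squares_le_2) auto
  finally show ?thesis by simp
qed

lemma region_num_le:
  "wsum (region x a b) (\<lambda>m n. of_bool (m \<in> E)) \<le> ln (b / a) * lsum E (b * x) + (2 + ln (b + 2))"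
proof -
  let ?M = "{m. m > 0 \<and> real m \<le> b * x}"
  have "wsum (region x a b) (\<lambda>m n. of_bool (m \<in> E))
      = (\<Sum>m\<in>?M. \<Sum>n | (m, n) \<in> region x a b. of_bool (m \<in> E) / (real m * real n))"
    unfolding wsum_def using region_le[of _ _ x a b] ab
    by (intro sum_slices(2) finite_region finite_pos_nat_le) (auto simp: region_def)
  also have "\<dots> = (\<Sum>m\<in>?M. of_bool (m \<in> E) / real m * (\<Sum>n | (m, n) \<in> region x a b. 1 / real n))"
    by (simp add: sum_distrib_left)
  also have "\<dots> \<le> (\<Sum>m\<in>?M. of_bool (m \<in> E) / real m * (min 1 (b / real m) + ln (b / a)))"
    by (intro sum_mono mult_left_mono region_den_slice) auto
  also have "\<dots> \<le> (\<Sum>m\<in>?M. min 1 (b / real m) / real m + ln (b / a) * (of_bool (m \<in> E) / real m))"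
    using ab by (intro sum_mono) (auto simp: add_divide_distrib)
  also have "\<dots> = (\<Sum>m\<in>?M. min 1 (b / real m) / real m) + ln (b / a) * lsum E (b * x)"
    unfolding lsum_of_bool sum.distrib sum_distrib_left ..
  also have "\<dots> \<le> (2 + ln (b + 2)) + ln (b / a) * lsum E (b * x)"
    using ab finite_pos_nat_le(2) by (intro add_right_mono sum_min_inverse_le) auto
  finally show ?thesis by simp
qed

text \<open>Rows contribute at most 2 / a and columns at most 2 + ln (b + 2): these are the
  quantities that condition (ii) makes small against ln (b / a) ln x.\<close>

lemma region_slice_error:
  assumes "2 / a + (2 + ln (b + 2)) \<le> e"
  shows "slice_error (region x a b) e"
proof -
  let ?K = "{n. n > 0 \<and> real n \<le> x}" and ?M = "{m. m > 0 \<and> real m \<le> b * x}"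
  have "(\<Sum>n\<in>?K. 1 / (a * real n) / real n) = 1 / a * (\<Sum>n\<in>?K. 1 / (real n)\<^sup>2)"
    unfolding sum_distrib_left by (intro sum.cong) (auto simp: power2_eq_square)
  also have "\<dots> \<le> 1 / a * 2" using ab by (intro mult_left_mono sum_inverse_squares_le_2) auto
  finally have "(\<Sum>n\<in>?K. 1 / (a * real n) / real n) \<le> 2 / a" by simp
  moreover have "(\<Sum>m\<in>?M. min 1 (b / real m) / real m) \<le> 2 + ln (b + 2)"
    using ab finite_pos_nat_le(2) by (intro sum_min_inverse_le) auto
  ultimately have s: "(\<Sum>n\<in>?K. 1 / (a * real n) / real n)
      + (\<Sum>m\<in>?M. min 1 (b / real m) / real m) \<le> e"
    using assms by linarith
  show ?thesis
  proof (rule slice_errorI[OF finite_pos_nat_le(2) finite_pos_nat_le(2) _ _ _ _ _ s])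
    show "region x a b \<subseteq> ?M \<times> ?K"
      using region_le[of _ _ x a b] ab by (auto simp: region_def)
  qed (use ab region_den_bound in auto)
qed

end

lemma farey_regions_pos:
  assumes c: "c\<^sub>2 > 0" "c\<^sub>3 > 0" and a: "\<forall>x\<ge>1. a x > 0"
    and ab: "\<forall>\<^sub>F x in at_top. c\<^sub>2 / ln (b x + 2) < a x \<and> a x < b x \<and> b x < x powr c\<^sub>3"
    and lim: "filterlim (\<lambda>x. 1 / ln (b x + 2) * ln (b x / a x) * ln x) at_top at_top"
  shows "farey_regions (\<lambda>x. region x (a x) (b x))"
proof -
  define T where "T x = ln (b x + 2)" for x
  define V where "V x = ln (b x / a x) * ln x" for x
  \<comment> \<open>The lower bound for \<open>a x\<close> gives 2 / a <= (2 /
    \<open>c\<^sub>2\<close>) T, and T >= 1 / 2 gives 2 + T <= 5 T.\<close>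
  define Q where "Q = 2 / c\<^sub>2 + 5"
  have Q: "Q > 0" using c by (simp add: Q_def add_pos_pos)
  let ?W = "\<lambda>x. wsum (region x (a x) (b x)) (\<lambda>m n. 1)"
  have base: "\<forall>\<^sub>F x in at_top. 0 < a x \<and> a x < b x \<and> x \<ge> 1 \<and> ln x > 0 \<and> ln (b x / a x) > 0 \<and>
      b x < x powr c\<^sub>3 \<and> 2 / a x + (2 + T x) \<le> Q * T x \<and> T x > 0"
    using ab eventually_gt_at_top[of 1]
  proof eventually_elim
    case (elim x)
    have a0: "a x > 0" using a elim by simp
    have "ln 2 \<le> T x" unfolding T_def using a0 elim by (intro ln_mono) auto
    then have T: "T x \<ge> 1 / 2" using inverse_Suc_le_ln(1)[of 1] by simp
    have "c\<^sub>2 < a x * T x" using elim T by (simp add: T_def divide_less_eq)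
    then have "2 / a x \<le> 2 / c\<^sub>2 * T x" using a0 c by (simp add: field_simps)
    then have "2 / a x + (2 + T x) \<le> Q * T x" using T by (simp add: Q_def algebra_simps)
    then show ?case using a0 elim T by simp
  qed
  have small: "\<forall>\<^sub>F x in at_top. Q * T x \<le> \<eta> * V x" if \<eta>: "\<eta> > 0" for \<eta>
  proof -
    have "\<forall>\<^sub>F x in at_top. Q / \<eta> \<le> 1 / ln (b x + 2) * ln (b x / a x) * ln x"
      using lim by (simp add: filterlim_at_top)
    then show ?thesis using base
    proof eventually_elim
      case (elim x)
      then have "Q / \<eta> \<le> V x / T x" by (simp add: V_def T_def)
      then show ?case using elim \<eta> by (simp add: field_simps)
    qed
  qed
  have Wge: "\<forall>\<^sub>F x in at_top. ?W x \<ge> V x / 2 \<and> V x > 0"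
    using small[OF half_gt_zero[OF zero_less_one]] base
  proof eventually_elim
    case (elim x)
    have "V x - 2 / a x \<le> ?W x" unfolding V_def using elim by (intro region_wsum_ge) auto
    moreover have "V x > 0" unfolding V_def using elim by (intro mult_pos_pos) blast+
    ultimately show ?case using elim by simp
  qed
  show ?thesis
  proof (rule farey_regionsI)
    show "\<forall>\<^sub>F x in at_top. 0 \<le> a x \<and> a x < b x" using base by eventually_elim auto
    show "\<forall>\<^sub>F x in at_top. ?W x > 0" using Wge by eventually_elim linarith
    fix \<epsilon> :: real assume \<epsilon>: "\<epsilon> > 0"
    have VW: "\<epsilon> / 2 * V x \<le> \<epsilon> * ?W x" if "V x / 2 \<le> ?W x" for x
      using mult_left_mono[OF that, of \<epsilon>] \<epsilon> by simp
    show "\<forall>\<^sub>F x in at_top. slice_error (region x (a x) (b x)) (\<epsilon> * ?W x)"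
      using base small[OF half_gt_zero[OF \<epsilon>]] Wge
    proof eventually_elim
      case (elim x)
      then have "2 / a x + (2 + ln (b x + 2)) \<le> \<epsilon> * ?W x"
        using VW[of x] unfolding T_def by linarith
      then show ?case using elim by (intro region_slice_error) auto
    qed
    \<comment> \<open>Of the factor \<open>c\<^sub>3 + 3\<close>, the part
      \<open>c\<^sub>3 + 1\<close> comes from the logarithm of the cutoff, one unit absorbs
      \<open>C\<close> and one absorbs \<open>Q * T x\<close>. The 2 is needed because the weight is
      only known to be at least \<open>V x / 2\<close>.\<close>
    define \<delta> where "\<delta> = \<epsilon> / (2 * (c\<^sub>3 + 3))"
    have \<delta>: "\<delta> > 0" using \<epsilon> c by (simp add: \<delta>_def)
    have \<delta>\<epsilon>: "\<delta> * (c\<^sub>3 + 3) = \<epsilon> / 2" using c by (simp add: \<delta>_def field_simps)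
    \<comment> \<open>One cutoff serves both variables: \<open>x\<close> and \<open>b x * x\<close>
      are both at most \<open>x powr (c\<^sub>3 + 1)\<close>.\<close>
    have bound: "\<forall>\<^sub>F x in at_top. ln (b x / a x) * lsum E (x powr (c\<^sub>3 + 1)) + Q * T x \<le> \<epsilon> * ?W x"
      if E: "thin \<delta> E" for E
    proof -
      obtain C where C: "C \<ge> 0" "\<And>y. y \<ge> 1 \<Longrightarrow> lsum E y \<le> \<delta> * ln y + C"
        using E unfolding thin_def by blast
      have "\<forall>\<^sub>F x in at_top. ln x \<ge> C / \<delta>" using ln_at_top by (simp add: filterlim_at_top)
      then show ?thesis using base small[OF \<delta>] Wge
      proof eventually_elim
        case (elim x)
        have "C \<le> \<delta> * ln x" using elim(1) \<delta> by (simp add: divide_le_eq mult.commute)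
        moreover have "x powr (c\<^sub>3 + 1) \<ge> 1" using elim c by (intro ge_one_powr_ge_zero) auto
        then have "lsum E (x powr (c\<^sub>3 + 1)) \<le> \<delta> * ln (x powr (c\<^sub>3 + 1)) + C" by (rule C)
        moreover have "ln (x powr (c\<^sub>3 + 1)) = (c\<^sub>3 + 1) * ln x" using elim by (simp add: ln_powr)
        ultimately have "lsum E (x powr (c\<^sub>3 + 1)) \<le> \<delta> * (c\<^sub>3 + 2) * ln x"
          by (simp add: algebra_simps)
        then have "ln (b x / a x) * lsum E (x powr (c\<^sub>3 + 1)) \<le> ln (b x / a x) * (\<delta> * (c\<^sub>3 + 2) * ln x)"
          using elim by (intro mult_left_mono) auto
        also have "\<dots> = \<delta> * (c\<^sub>3 + 2) * V x" by (simp add: V_def)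
        finally have "ln (b x / a x) * lsum E (x powr (c\<^sub>3 + 1)) + Q * T x \<le> \<delta> * (c\<^sub>3 + 3) * V x"
          using elim(3) by (simp add: algebra_simps)
        then show ?case unfolding \<delta>\<epsilon> using VW[of x] elim by linarith
      qed
    qed
    show "\<exists>\<delta>>0. \<forall>E. thin \<delta> E \<longrightarrow>
      (\<forall>\<^sub>F x in at_top. wsum (region x (a x) (b x)) (\<lambda>m n. of_bool (m \<in> E)) \<le> \<epsilon> * ?W x)"
    proof (intro exI[of _ \<delta>] conjI \<delta> allI impI)
      fix E assume "thin \<delta> E"
      from bound[OF this] base
      show "\<forall>\<^sub>F x in at_top. wsum (region x (a x) (b x)) (\<lambda>m n. of_bool (m \<in> E)) \<le> \<epsilon> * ?W x"
      proof eventually_elim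
        case (elim x)
        have "b x * x \<le> x powr c\<^sub>3 * x powr 1" using elim by (intro mult_mono) auto
        then have "b x * x \<le> x powr (c\<^sub>3 + 1)" by (simp only: powr_add)
        then have "ln (b x / a x) * lsum E (b x * x) \<le> ln (b x / a x) * lsum E (x powr (c\<^sub>3 + 1))"
          using elim by (intro mult_left_mono lsum_mono) auto
        moreover have "wsum (region x (a x) (b x)) (\<lambda>m n. of_bool (m \<in> E))
            \<le> ln (b x / a x) * lsum E (b x * x) + (2 + ln (b x + 2))"
          using elim by (intro region_num_le) auto
        moreover have "2 / a x > 0" using elim by simp
        ultimately show ?case using elim unfolding T_def by linarith
      qed
    qed
    show "\<exists>\<delta>>0. \<forall>E. thin \<delta> E \<longrightarrow>
      (\<forall>\<^sub>F x in at_top. wsum (region x (a x) (b x)) (\<lambda>m n. of_bool (n \<in> E)) \<le> \<epsilon> * ?W x)"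
    proof (intro exI[of _ \<delta>] conjI \<delta> allI impI)
      fix E assume "thin \<delta> E"
      from bound[OF this] base
      show "\<forall>\<^sub>F x in at_top. wsum (region x (a x) (b x)) (\<lambda>m n. of_bool (n \<in> E)) \<le> \<epsilon> * ?W x"
      proof eventually_elim
        case (elim x)
        have "x powr 1 \<le> x powr (c\<^sub>3 + 1)" using elim c by (intro powr_mono) auto
        then have "x \<le> x powr (c\<^sub>3 + 1)" using elim by simp
        then have "ln (b x / a x) * lsum E x \<le> ln (b x / a x) * lsum E (x powr (c\<^sub>3 + 1))"
          using elim by (intro mult_left_mono lsum_mono) auto
        moreover have "wsum (region x (a x) (b x)) (\<lambda>m n. of_bool (n \<in> E))
            \<le> ln (b x / a x) * lsum E x + 2 / a x"
          using elim by (intro region_den_le) auto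
        ultimately show ?case using elim unfolding T_def by linarith
      qed
    qed
  qed
qed

subsection \<open>Passage to reduced fractions\<close>

lemma rnum_rden_eq:
  assumes "m > 0" "n > 0" "coprime m n"
  shows "rnum (of_nat m / of_nat n) = m" "rden (of_nat m / of_nat n) = n"
proof -
  define r :: rat where "r = of_nat m / of_nat n"
  have r0: "r > 0" using assms by (simp add: r_def)
  note R = rat_reduced[OF r0]
  have "of_nat (rnum r) / of_nat (rden r) = (of_nat m / of_nat n :: rat)"
    using R(4) r_def by metis
  then have "(of_nat (rnum r * n) :: rat) = of_nat (m * rden r)"
    using R(2) assms(2) by (simp add: frac_eq_eq)
  then have "rnum r * n = m * rden r" by (simp only: of_nat_eq_iff)
  then have "rnum r = m \<and> n = rden r"
    using coprime_crossproduct_nat[of "rnum r" "rden r" m n] R(3) assms(3)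
    by (simp add: mult.commute coprime_commute)
  then show "rnum (of_nat m / of_nat n) = m" "rden (of_nat m / of_nat n) = n"
    by (auto simp: r_def)
qed

lemma of_rat_reduced:
  assumes "r > 0"
  shows "(of_rat r :: real) = real (rnum r) / real (rden r)"
  by (subst rat_reduced(4)[OF assms]) (simp add: of_rat_divide)

lemma S11_rat_multiples:
  "S11 x {a<..<b} (rat_multiples A B q) = wsum (region x a b) (\<lambda>m n. of_bool (admissible A B q m n))"
proof -
  have "wsum (region x a b) (\<lambda>m n. of_bool (admissible A B q m n))
      = (\<Sum>(m, n)\<in>{(m, n) \<in> region x a b. admissible A B q m n}. 1 / (real m * real n))"
    unfolding wsum_def using finite_region by (intro sum.mono_neutral_cong_right) auto
  also have "\<dots> = (\<Sum>r \<in> farey x {a<..<b} \<inter> rat_multiples A B q. 1 / (real (rnum r) * real (rden r)))"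
  proof (rule sum.reindex_bij_witness[of _ "\<lambda>r. (rnum r, rden r)" "\<lambda>(m, n). of_nat m / of_nat n"])
    fix z assume "z \<in> {(m, n) \<in> region x a b. admissible A B q m n}"
    then obtain m n where z: "z = (m, n)" "(m, n) \<in> region x a b" "admissible A B q m n" by auto
    then have mn: "m > 0" "n > 0" "coprime m n" by (auto simp: region_def admissible_def)
    note R = rnum_rden_eq[OF mn]
    show "(\<lambda>r. (rnum r, rden r)) ((\<lambda>(m, n). of_nat m / of_nat n) z) = z" using z R by simp
    show "1 / (real (rnum ((\<lambda>(m, n). of_nat m / of_nat n) z)) *
        real (rden ((\<lambda>(m, n). of_nat m / of_nat n) z))) = (case z of (m, n) \<Rightarrow> 1 / (real m * real n))"
      using z R by simp
    have "(of_rat (of_nat m / of_nat n) :: real) = real m / real n" by (simp add: of_rat_divide)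
    then show "(\<lambda>(m, n). of_nat m / of_nat n) z \<in> farey x {a<..<b} \<inter> rat_multiples A B q"
      using z mn R by (auto simp: farey_def rat_multiples_def admissible_def region_def
          pos_less_divide_eq pos_divide_less_eq)
  next
    fix r assume r: "r \<in> farey x {a<..<b} \<inter> rat_multiples A B q"
    then have r0: "r > 0" by (auto simp: farey_def)
    note R = rat_reduced[OF r0]
    show "(\<lambda>(m, n). of_nat m / of_nat n) (rnum r, rden r) = r" using R(4) by simp
    show "(rnum r, rden r) \<in> {(m, n) \<in> region x a b. admissible A B q m n}"
      using r R(1-3) of_rat_reduced[OF r0]
      by (auto simp: farey_def rat_multiples_def admissible_def region_def
          pos_less_divide_eq pos_divide_less_eq)
  qed
  finally show ?thesis by (simp add: S11_def)
qed

lemma S11_farey: "S11 x I (farey x I) = S11 x I (rat_multiples {1} {1} 1)"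
proof -
  have "farey x I \<inter> farey x I = farey x I \<inter> rat_multiples {1} {1} 1"
    using rat_reduced by (auto simp: farey_def rat_multiples_def multiples_def)
  then show ?thesis by (simp add: S11_def)
qed

lemma nu11_tendsto:
  assumes "farey_regions (\<lambda>x. region x (a x) (b x))" "q > 0"
  shows "\<exists>l. ((\<lambda>x. nu11 x {a x<..<b x} (rat_multiples A B q)) \<longlongrightarrow> l) at_top"
  using farey_regions.admissible_ratio[OF assms]
  unfolding nu11_def S11_farey S11_rat_multiples .

theorem theorem5:
  fixes lam\<^sub>1 lam\<^sub>2 :: "real \<Rightarrow> real" and A B :: "nat set" and q :: nat
  assumes "\<forall>x\<ge>1. 0 \<le> lam\<^sub>1 x \<and> lam\<^sub>1 x < lam\<^sub>2 x"
    and "((\<forall>x\<ge>1. lam\<^sub>1 x = 0) \<and>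
          filterlim (\<lambda>x. lam\<^sub>2 x * x) at_top at_top \<and>
          (\<exists>c\<^sub>1>0. \<forall>\<^sub>F x in at_top. ln x / ln (lam\<^sub>2 x * x) < c\<^sub>1))
       \<or> ((\<forall>x\<ge>1. lam\<^sub>1 x > 0) \<and>
          (\<exists>c\<^sub>2>0. \<exists>c\<^sub>3>0. \<forall>\<^sub>F x in at_top.
             c\<^sub>2 / ln (lam\<^sub>2 x + 2) < lam\<^sub>1 x \<and> lam\<^sub>1 x < lam\<^sub>2 x \<and> lam\<^sub>2 x < x powr c\<^sub>3) \<and>
          filterlim (\<lambda>x. 1 / ln (lam\<^sub>2 x + 2) * ln (lam\<^sub>2 x / lam\<^sub>1 x) * ln x) at_top at_top)"
    and "A \<subseteq> {0<..}" and "B \<subseteq> {0<..}" and "q > 0"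
  shows "\<exists>l. ((\<lambda>x. nu11 x {lam\<^sub>1 x<..<lam\<^sub>2 x} (rat_multiples A B q)) \<longlongrightarrow> l) at_top"
  using assms(2)
proof (elim disjE conjE exE)
  fix c\<^sub>1 :: real
  assume z: "\<forall>x\<ge>1. lam\<^sub>1 x = 0" and lim: "filterlim (\<lambda>x. lam\<^sub>2 x * x) at_top at_top"
    and c1: "c\<^sub>1 > 0" "\<forall>\<^sub>F x in at_top. ln x / ln (lam\<^sub>2 x * x) < c\<^sub>1"
  have "\<forall>x\<ge>1. lam\<^sub>2 x > 0" using assms(1) by force
  then obtain l where l: "((\<lambda>x. nu11 x {0<..<lam\<^sub>2 x} (rat_multiples A B q)) \<longlongrightarrow> l) at_top"
    using nu11_tendsto[OF farey_regions_zero[OF _ lim c1] assms(5)] by blast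
  \<comment> \<open>The left endpoint is prescribed only for x >= 1, so the two functions agree just
    eventually.\<close>
  have "\<forall>\<^sub>F x in at_top. nu11 x {0<..<lam\<^sub>2 x} (rat_multiples A B q)
      = nu11 x {lam\<^sub>1 x<..<lam\<^sub>2 x} (rat_multiples A B q)"
    using eventually_ge_at_top[of 1] by eventually_elim (use z in simp)
  then show ?thesis using l tendsto_cong by (intro exI[of _ l]) fast
next
  fix c\<^sub>2 c\<^sub>3 :: real
  assume p: "\<forall>x\<ge>1. lam\<^sub>1 x > 0" and c: "c\<^sub>2 > 0" "c\<^sub>3 > 0"
    and e: "\<forall>\<^sub>F x in at_top.
      c\<^sub>2 / ln (lam\<^sub>2 x + 2) < lam\<^sub>1 x \<and> lam\<^sub>1 x < lam\<^sub>2 x \<and> lam\<^sub>2 x < x powr c\<^sub>3"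
    and lim: "filterlim (\<lambda>x. 1 / ln (lam\<^sub>2 x + 2) * ln (lam\<^sub>2 x / lam\<^sub>1 x) * ln x) at_top at_top"
  show ?thesis by (rule nu11_tendsto[OF farey_regions_pos[OF c p e lim] assms(5)])
qed

end
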